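(* Let $\psi:\Sigma^k\longrightarrow \overline{M}^{n+2}$ be a complete, orientable, non-compact spacelike submanifold in a plane fronted wave $\overline{M}^{n+2}$, with mean curvature vector field $\overrightarrow{H}$, and let $\mu:=u\circ\psi$. Let $r(p)=d(p,o)$ denote the Riemannian distance function on $\Sigma^k$ from a fixed point $o\in\Sigma^k$, and let $u_0\in\mathbb{R}$. (i) If $\langle \overrightarrow{H},\partial_v\rangle\geq 0$ on $\Sigma^k$, $\mu\geq u_0$ on $\Sigma^k$, and $\lim_{r(p)\to\infty}\mu(p)=u_0$, then $\mu= u_0$ identically on $\Sigma^k$. (ii) If $\langle \overrightarrow{H},\partial_v\rangle\leq 0$ on $\Sigma^k$, $\mu\leq u_0$ on $\Sigma^k$, and $\lim_{r(p)\to\infty}\mu(p)=u_0$, then $\mu= u_0$ identically on $\Sigma^k$.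
   Context: A plane fronted wave is a Lorentzian manifold $(\overline{M}^{n+2},\langle\ ,\ \rangle)$ with $\overline{M}^{n+2}=\mathbb{R}^2\times M^n$, where $(M^n,g_M)$ is a connected Riemannian manifold, and metric $\langle\ ,\ \rangle=\mathcal{H}(u,x)\,du\otimes du+du\otimes dv+dv\otimes du+g_M$, where $(u,v)$ are the natural coordinates on $\mathbb{R}^2$ and $\mathcal{H}(u,x)$ is a smooth function on $\mathbb{R}^2\times M^n$ independent of $v$. The coordinate vector field $\partial_v=\partial/\partial v$ is lightlike and parallel. A spacelike submanifold $\psi:\Sigma^k\to\overline{M}^{n+2}$ is an immersion of a connected $k$-dimensional manifold whose induced metric (also denoted $\langle\ ,\ \rangle$) is Riemannian; complete refers to this induced metric. Its mean curvature vector field is $\overrightarrow{H}=\frac1k\,\mathrm{trace}_{\langle\ ,\ \rangle}(\mathrm{II})$, where $\mathrm{II}$ is the second fundamental form, defined by $\overline{\nabla}_XY=\nabla_XY+\mathrm{II}(X,Y)$, with $\overline\nabla$, $\nabla$ the Levi-Civita connections of $\overline{M}^{n+2}$ and $\Sigma^k$. *)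

theory Defs
  imports "HOL-Analysis.Analysis"
begin

section \<open>Smooth maps between Euclidean spaces\<close>

primrec Ck_on :: "nat \<Rightarrow> 'a::euclidean_space set \<Rightarrow> ('a \<Rightarrow> 'b::euclidean_space) \<Rightarrow> bool" where
  "Ck_on 0 S f \<longleftrightarrow> continuous_on S f"
| "Ck_on (Suc k) S f \<longleftrightarrow> (\<forall>x\<in>S. f differentiable (at x)) \<and>
     (\<forall>v. Ck_on k S (\<lambda>x. frechet_derivative f (at x) v))"

text \<open>Only used for open \<open>S\<close>.\<close>

definition smooth_on :: "'a::euclidean_space set \<Rightarrow> ('a \<Rightarrow> 'b::euclidean_space) \<Rightarrow> bool" where
  "smooth_on S f \<longleftrightarrow> (\<forall>k. Ck_on k S f)"

section \<open>Manifolds, given by an atlas on a type\<close>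

text \<open>
  A chart is a pair \<open>(U, \<phi>)\<close> of an open set and a coordinate map that is a homeomorphism of \<open>U\<close>
  onto an open subset of the model space.  The manifold is the whole type \<open>'a\<close>; the Hausdorff and
  second countability axioms are type class assumptions on \<open>'a\<close>, and the dimension is that of the
  model space.
\<close>

type_synonym ('a, 'e) chart = "'a set \<times> ('a \<Rightarrow> 'e)"

definition is_chart :: "('a::topological_space, 'e::euclidean_space) chart \<Rightarrow> bool" where
  "is_chart c \<longleftrightarrow> open (fst c) \<and> open (snd c ` fst c) \<and>
     homeomorphism (fst c) (snd c ` fst c) (snd c) (inv_into (fst c) (snd c))"

definition local_rep ::
  "('a, 'e) chart \<Rightarrow> ('b, 'f) chart \<Rightarrow> ('a \<Rightarrow> 'b) \<Rightarrow> 'e \<Rightarrow> 'f" where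
  "local_rep c d f = snd d \<circ> f \<circ> inv_into (fst c) (snd c)"

definition smooth_compatible ::
  "('a, 'e::euclidean_space) chart \<Rightarrow> ('a, 'e) chart \<Rightarrow> bool" where
  "smooth_compatible c d \<longleftrightarrow>
     smooth_on (snd c ` (fst c \<inter> fst d)) (local_rep c d id) \<and>
     smooth_on (snd d ` (fst c \<inter> fst d)) (local_rep d c id)"

definition smooth_atlas ::
  "('a::{t2_space, second_countable_topology}, 'e::euclidean_space) chart set \<Rightarrow> bool" where
  "smooth_atlas A \<longleftrightarrow> (\<forall>c\<in>A. is_chart c) \<and> (\<Union>c\<in>A. fst c) = UNIV \<and>
     (\<forall>c\<in>A. \<forall>d\<in>A. smooth_compatible c d)"

definition orientable ::
  "('a::{t2_space, second_countable_topology}, real^'k) chart set \<Rightarrow> bool" where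
  "orientable A \<longleftrightarrow> (\<exists>B. smooth_atlas B \<and> (\<forall>c\<in>A. \<forall>d\<in>B. smooth_compatible c d) \<and>
     (\<forall>c\<in>B. \<forall>d\<in>B. \<forall>p\<in>fst c \<inter> fst d.
        0 < det (matrix (frechet_derivative (local_rep c d id) (at (snd c p))))))"

definition smooth_map ::
  "('a::topological_space, 'e::euclidean_space) chart set \<Rightarrow>
   ('b::topological_space, 'f::euclidean_space) chart set \<Rightarrow> ('a \<Rightarrow> 'b) \<Rightarrow> bool" where
  "smooth_map A B f \<longleftrightarrow> continuous_on UNIV f \<and>
     (\<forall>c\<in>A. \<forall>d\<in>B. smooth_on (snd c ` (fst c \<inter> f -` fst d)) (local_rep c d f))"

definition immersion ::
  "('a::topological_space, 'e::euclidean_space) chart set \<Rightarrow>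
   ('b::topological_space, 'f::euclidean_space) chart set \<Rightarrow> ('a \<Rightarrow> 'b) \<Rightarrow> bool" where
  "immersion A B f \<longleftrightarrow> smooth_map A B f \<and>
     (\<forall>c\<in>A. \<forall>d\<in>B. \<forall>p\<in>fst c \<inter> f -` fst d.
        inj (frechet_derivative (local_rep c d f) (at (snd c p))))"

section \<open>Metric tensors and the Levi-Civita connection\<close>

text \<open>
  A metric tensor is a family of local representatives: \<open>g c x v w\<close> is the product of the vectors
  with components \<open>v\<close> and \<open>w\<close> at the point with coordinates \<open>x\<close>, all with respect to the chart
  \<open>c\<close>.
\<close>

type_synonym ('a, 'e) metric_tensor = "('a, 'e) chart \<Rightarrow> 'e \<Rightarrow> 'e \<Rightarrow> 'e \<Rightarrow> real"

definition riemannian_metric ::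
  "('a, 'e::euclidean_space) chart set \<Rightarrow> ('a, 'e) metric_tensor \<Rightarrow> bool" where
  "riemannian_metric A g \<longleftrightarrow>
     (\<forall>c\<in>A. \<forall>x\<in>snd c ` fst c. bilinear (g c x) \<and> (\<forall>v w. g c x v w = g c x w v) \<and>
        (\<forall>v. v \<noteq> 0 \<longrightarrow> 0 < g c x v v)) \<and>
     (\<forall>c\<in>A. \<forall>v w. smooth_on (snd c ` fst c) (\<lambda>x. g c x v w)) \<and>
     (\<forall>c\<in>A. \<forall>d\<in>A. \<forall>p\<in>fst c \<inter> fst d. \<forall>v w.
        (let T = frechet_derivative (local_rep c d id) (at (snd c p))
         in g c (snd c p) v w = g d (snd d p) (T v) (T w)))"

text \<open>
  In a chart, a connection is \<open>(\<nabla>\<^bsub>X\<^esub>Y)(x) = DY(x)(X x) + \<Gamma> x (X x) (Y x)\<close> with \<open>\<Gamma> x\<close> bilinear.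
  It is torsion free iff every \<open>\<Gamma> x\<close> is symmetric, and compatible with the metric iff the product
  rule holds for constant coordinate fields.  These two properties determine \<open>\<Gamma> x\<close> uniquely when
  the metric is symmetric and nondegenerate; see \<open>levi_civita_at_ex1\<close> below.
\<close>

definition levi_civita_at ::
  "('e::euclidean_space \<Rightarrow> 'e \<Rightarrow> 'e \<Rightarrow> real) \<Rightarrow> 'e \<Rightarrow> ('e \<Rightarrow> 'e \<Rightarrow> 'e) \<Rightarrow> bool" where
  "levi_civita_at G x \<Gamma> \<longleftrightarrow> bilinear \<Gamma> \<and> (\<forall>v w. \<Gamma> v w = \<Gamma> w v) \<and>
     (\<forall>u v w. frechet_derivative (\<lambda>y. G y v w) (at x) u = G x (\<Gamma> u v) w + G x v (\<Gamma> u w))"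

definition christoffel ::
  "('e::euclidean_space \<Rightarrow> 'e \<Rightarrow> 'e \<Rightarrow> real) \<Rightarrow> 'e \<Rightarrow> 'e \<Rightarrow> 'e \<Rightarrow> 'e" where
  "christoffel G x = (THE \<Gamma>. levi_civita_at G x \<Gamma>)"

lemma levi_civita_at_ex1:
  fixes G :: "'e::euclidean_space \<Rightarrow> 'e \<Rightarrow> 'e \<Rightarrow> real"
  assumes S: "open S" "x \<in> S"
    and bil: "\<And>y. y \<in> S \<Longrightarrow> bilinear (G y)"
    and sym: "\<And>y v w. y \<in> S \<Longrightarrow> G y v w = G y w v"
    and diff: "\<And>v w. (\<lambda>y. G y v w) differentiable (at x)"
    and nondeg: "\<And>v. (\<And>w. G x v w = 0) \<Longrightarrow> v = 0"
  shows "\<exists>!\<Gamma>. levi_civita_at G x \<Gamma>"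
proof -
  define D where "D v w u = frechet_derivative (\<lambda>y. G y v w) (at x) u" for u v w
  have bx: "bilinear (G x)" and sx: "G x v w = G x w v" for v w
    using bil sym S by auto
  have Dder: "((\<lambda>y. G y v w) has_derivative D v w) (at x)" for v w
    unfolding D_def using diff frechet_derivative_works by blast
  have Deq: "D v w = D'" if "(f has_derivative D') (at x)" "\<And>y. y \<in> S \<Longrightarrow> f y = G y v w" for D' f v w
  proof -
    have "((\<lambda>y. G y v w) has_derivative D') (at x)"
      by (rule has_derivative_transform_within_open[OF that(1) S]) (rule that(2))
    from has_derivative_unique[OF Dder this] show ?thesis .
  qed
  have Dsym: "D v w u = D w v u" for u v w
  proof -
    have "D v w = D w v" by (rule Deq[OF Dder]) (rule sym)
    then show ?thesis by simp
  qed
  have Dlin: "linear (D v w)" for v w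
    using Dder has_derivative_linear by blast
  have Dadd: "D (v + v') w u = D v w u + D v' w u" for u v v' w
  proof -
    have "D (v + v') w = (\<lambda>u. D v w u + D v' w u)"
      by (rule Deq[OF has_derivative_add[OF Dder Dder]]) (simp add: bilinear_ladd[OF bil])
    then show ?thesis by simp
  qed
  have Dscale: "D (a *\<^sub>R v) w u = a * D v w u" for a u v w
  proof -
    have "D (a *\<^sub>R v) w = (\<lambda>u. a * D v w u)"
      by (rule Deq[OF has_derivative_mult_right[OF Dder]]) (simp add: bilinear_lmul[OF bil])
    then show ?thesis by simp
  qed
  have Dadd2: "D w (v + v') u = D w v u + D w v' u" for u v v' w
    using Dadd Dsym by metis
  have Dscale2: "D w (a *\<^sub>R v) u = a * D w v u" for a u v w
    using Dscale Dsym by metis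
  define K where "K u v w = (D v w u + D w u v - D u v w) / 2" for u v w
  have eq: "z = z'" if "\<And>w. G x z w = G x z' w" for z z'
  proof -
    have "z - z' = 0" by (rule nondeg) (simp add: bilinear_lsub[OF bx] that)
    then show ?thesis by simp
  qed
  have rep: "\<exists>!z. \<forall>w. G x z w = l w" if l: "linear l" for l :: "'e \<Rightarrow> real"
  proof -
    define f where "f z = (\<Sum>b\<in>Basis. G x z b *\<^sub>R b)" for z
    have fin: "f z \<bullet> b = G x z b" if "b \<in> Basis" for z b
      unfolding f_def by (rule inner_sum_left_Basis[OF that])
    have ext: "h = h'" if "linear h" "linear h'" "\<And>b. b \<in> Basis \<Longrightarrow> h b = h' b"
      for h h' :: "'e \<Rightarrow> real"
      using linear_eq_stdbasis[OF that] by auto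
    have Glin: "linear (G x z)" for z using bx by (simp add: bilinear_def)
    have "linear f"
      by (rule linearI; rule euclidean_eqI)
        (simp_all add: fin inner_add_left bilinear_ladd[OF bx] bilinear_lmul[OF bx])
    moreover have "inj f"
    proof (subst linear_injective_0[OF \<open>linear f\<close>], intro allI impI)
      fix z assume "f z = 0"
      then have "G x z b = 0" if "b \<in> Basis" for b using fin[OF that, of z] by simp
      then have "G x z = (\<lambda>_. 0)" by (intro ext Glin linear_zero) auto
      then show "z = 0" using nondeg by metis
    qed
    ultimately have sf: "surj f" using linear_injective_imp_surjective by blast
    obtain z where z: "f z = (\<Sum>b\<in>Basis. l b *\<^sub>R b)" using sf by (metis surjD)
    have "G x z b = l b" if "b \<in> Basis" for b
      using fin[OF that, of z] inner_sum_left_Basis[OF that, of l] unfolding z by simp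
    then have z_eq: "G x z = l" by (intro ext Glin l) auto
    show ?thesis
    proof (rule ex1I[of _ z])
      show "\<forall>w. G x z w = l w" using z_eq by simp
      show "z' = z" if "\<forall>w. G x z' w = l w" for z'
        using that by (intro eq) (simp add: z_eq)
    qed
  qed
  have Kl: "linear (K u v)" for u v
    unfolding K_def
    by (rule linearI)
      (simp_all add: linear_add[OF Dlin] linear_scale[OF Dlin] Dadd Dscale Dadd2 Dscale2 field_simps)
  define \<Gamma> where "\<Gamma> u v = (THE z. \<forall>w. G x z w = K u v w)" for u v
  have \<Gamma>: "G x (\<Gamma> u v) w = K u v w" for u v w
    using theI'[OF rep[OF Kl[of u v]]] unfolding \<Gamma>_def by blast
  have sG: "\<Gamma> u v = \<Gamma> v u" for u v
    by (rule eq) (simp add: \<Gamma> K_def Dsym)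
  have aG: "\<Gamma> u (v + v') = \<Gamma> u v + \<Gamma> u v'" for u v v'
    by (rule eq) (simp add: \<Gamma> K_def bilinear_ladd[OF bx] linear_add[OF Dlin] Dadd
        Dadd2 field_simps)
  have cG: "\<Gamma> u (a *\<^sub>R v) = a *\<^sub>R \<Gamma> u v" for a u v
    by (rule eq) (simp add: \<Gamma> K_def bilinear_lmul[OF bx] linear_scale[OF Dlin] Dscale
        Dscale2 field_simps)
  have "levi_civita_at G x \<Gamma>"
  proof -
    have "bilinear \<Gamma>"
      unfolding bilinear_def
    proof (intro conjI allI)
      show "linear (\<Gamma> u)" for u by (rule linearI) (simp_all add: aG cG)
      moreover have "(\<lambda>u. \<Gamma> u v) = \<Gamma> v" for v by (rule ext) (rule sG)
      ultimately show "linear (\<lambda>u. \<Gamma> u v)" for v by simp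
    qed
    moreover have "D v w u = G x (\<Gamma> u v) w + G x v (\<Gamma> u w)" for u v w
      using \<Gamma>[of u v w] \<Gamma>[of u w v] sx[of v "\<Gamma> u w"] Dsym[of v w u] Dsym[of u v w] Dsym[of u w v]
      unfolding K_def by argo
    ultimately show ?thesis unfolding levi_civita_at_def D_def using sG by blast
  qed
  moreover have "\<Gamma>' = \<Gamma>" if "levi_civita_at G x \<Gamma>'" for \<Gamma>'
  proof (intro ext)
    fix u v
    have s: "\<Gamma>' u v = \<Gamma>' v u" for u v using that unfolding levi_civita_at_def by blast
    have m: "D v w u = G x (\<Gamma>' u v) w + G x v (\<Gamma>' u w)" for u v w
      using that unfolding levi_civita_at_def D_def by blast
    show "\<Gamma>' u v = \<Gamma> u v"
    proof (rule eq)
      fix w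
      show "G x (\<Gamma>' u v) w = G x (\<Gamma> u v) w"
        unfolding \<Gamma> K_def m s[of v u] s[of w u] s[of w v]
        using sx[of w "\<Gamma>' u v"] sx[of v "\<Gamma>' u w"] sx[of u "\<Gamma>' v w"]
        by argo
    qed
  qed
  ultimately show ?thesis by blast
qed

text \<open>
  For a map with coordinate expression \<open>F\<close>, a vector field \<open>Z\<close> along \<open>F\<close> and a tangent vector \<open>v\<close>
  of the source at \<open>x\<close>: the derivative of \<open>Z\<close> along \<open>v\<close> with respect to the Levi-Civita connection
  of the metric \<open>G\<close> of the target.  With \<open>F\<close> the identity this is the Levi-Civita connection of
  \<open>G\<close> itself.
\<close>

definition cov_deriv_along ::
  "('f::euclidean_space \<Rightarrow> 'f \<Rightarrow> 'f \<Rightarrow> real) \<Rightarrow> ('e::euclidean_space \<Rightarrow> 'f) \<Rightarrow> ('e \<Rightarrow> 'f) \<Rightarrow>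
   'e \<Rightarrow> 'e \<Rightarrow> 'f" where
  "cov_deriv_along G F Z x v = frechet_derivative Z (at x) v +
     christoffel G (F x) (frechet_derivative F (at x) v) (Z x)"

section \<open>Riemannian distance\<close>

definition C1_curve ::
  "('a::topological_space, 'e::euclidean_space) chart set \<Rightarrow> real \<Rightarrow> real \<Rightarrow> (real \<Rightarrow> 'a) \<Rightarrow> bool"
  where
  "C1_curve A a b \<gamma> \<longleftrightarrow> continuous_on {a..b} \<gamma> \<and>
     (\<forall>c\<in>A. \<exists>D. continuous_on ({a..b} \<inter> \<gamma> -` fst c) D \<and>
        (\<forall>t\<in>{a..b} \<inter> \<gamma> -` fst c.
           ((snd c \<circ> \<gamma>) has_vector_derivative D t) (at t within {a..b})))"

definition piecewise_C1_curve ::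
  "('a::topological_space, 'e::euclidean_space) chart set \<Rightarrow> (real \<Rightarrow> 'a) \<Rightarrow> bool" where
  "piecewise_C1_curve A \<gamma> \<longleftrightarrow> (\<exists>(N::nat) t. t 0 = 0 \<and> t N = 1 \<and>
     (\<forall>i<N. t i < t (Suc i) \<and> C1_curve A (t i) (t (Suc i)) \<gamma>))"

text \<open>The speed at \<open>t\<close> does not depend on the chart that is chosen around \<open>\<gamma> t\<close>.\<close>

definition speed ::
  "('a, 'e::euclidean_space) chart set \<Rightarrow> ('a, 'e) metric_tensor \<Rightarrow> (real \<Rightarrow> 'a) \<Rightarrow> real \<Rightarrow> real"
  where
  "speed A g \<gamma> t =
     (let c = (SOME c. c \<in> A \<and> \<gamma> t \<in> fst c); v = vector_derivative (snd c \<circ> \<gamma>) (at t)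
      in sqrt (g c (snd c (\<gamma> t)) v v))"

definition curve_length ::
  "('a, 'e::euclidean_space) chart set \<Rightarrow> ('a, 'e) metric_tensor \<Rightarrow> (real \<Rightarrow> 'a) \<Rightarrow> real" where
  "curve_length A g \<gamma> = integral {0..1} (speed A g \<gamma>)"

definition riemannian_dist ::
  "('a::topological_space, 'e::euclidean_space) chart set \<Rightarrow> ('a, 'e) metric_tensor \<Rightarrow>
   'a \<Rightarrow> 'a \<Rightarrow> real" where
  "riemannian_dist A g p q =
     Inf {curve_length A g \<gamma> | \<gamma>. piecewise_C1_curve A \<gamma> \<and> \<gamma> 0 = p \<and> \<gamma> 1 = q}"

text \<open>
  Completeness is metric completeness for the Riemannian distance, which is a metric inducing the
  manifold topology when the manifold is connected.
\<close>

definition complete_riemannian ::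
  "('a::topological_space, 'e::euclidean_space) chart set \<Rightarrow> ('a, 'e) metric_tensor \<Rightarrow> bool" where
  "complete_riemannian A g \<longleftrightarrow> Metric_space.mcomplete UNIV (riemannian_dist A g)"

section \<open>Spacelike submanifolds and their mean curvature\<close>

text \<open>
  \<open>g\<close> is the induced metric: the last conjunct says that it is the pullback of the ambient metric
  \<open>h\<close>, and \<open>riemannian_metric\<close> that it is positive definite.
\<close>

definition spacelike_submanifold ::
  "('a::topological_space, 'e::euclidean_space) chart set \<Rightarrow> ('a, 'e) metric_tensor \<Rightarrow>
   ('b::topological_space, 'f::euclidean_space) chart set \<Rightarrow> ('b, 'f) metric_tensor \<Rightarrow>
   ('a \<Rightarrow> 'b) \<Rightarrow> bool" where
  "spacelike_submanifold A g B h \<psi> \<longleftrightarrow> immersion A B \<psi> \<and> riemannian_metric A g \<and>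
     (\<forall>c\<in>A. \<forall>d\<in>B. \<forall>p\<in>fst c \<inter> \<psi> -` fst d. \<forall>v w.
        (let T = frechet_derivative (local_rep c d \<psi>) (at (snd c p))
         in g c (snd c p) v w = h d (snd d (\<psi> p)) (T v) (T w)))"

text \<open>
  \<open>II(X, Y)\<close> at the point with coordinates \<open>x\<close>, for vector fields \<open>X\<close> and \<open>Y\<close> on the submanifold,
  with \<open>F\<close> the coordinate expression of the immersion, \<open>g\<close> the induced metric and \<open>h\<close> the ambient
  one.
\<close>

definition second_fundamental_form ::
  "('e::euclidean_space \<Rightarrow> 'e \<Rightarrow> 'e \<Rightarrow> real) \<Rightarrow> ('f::euclidean_space \<Rightarrow> 'f \<Rightarrow> 'f \<Rightarrow> real) \<Rightarrow>
   ('e \<Rightarrow> 'f) \<Rightarrow> ('e \<Rightarrow> 'e) \<Rightarrow> ('e \<Rightarrow> 'e) \<Rightarrow> 'e \<Rightarrow> 'f" where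
  "second_fundamental_form g h F X Y x =
     cov_deriv_along h F (\<lambda>y. frechet_derivative F (at y) (Y y)) x (X x) -
     frechet_derivative F (at x) (cov_deriv_along g id Y x (X x))"

text \<open>The trace of \<open>B\<close> with respect to an inner product does not depend on the orthonormal basis.\<close>

definition metric_trace ::
  "('e::euclidean_space \<Rightarrow> 'e \<Rightarrow> real) \<Rightarrow> ('e \<Rightarrow> 'e \<Rightarrow> 'f::real_vector) \<Rightarrow> 'f" where
  "metric_trace G B =
     (let E = (SOME E. finite E \<and> card E = DIM('e) \<and>
                 (\<forall>e\<in>E. \<forall>f\<in>E. G e f = (if e = f then 1 else 0)))
      in \<Sum>e\<in>E. B e e)"

text \<open>
  Components in the ambient chart \<open>d\<close> of the mean curvature vector at \<open>p\<close>, computed in the chart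
  \<open>c\<close> of the submanifold.  As \<open>II\<close> is tensorial, vectors are extended to fields with constant
  components.
\<close>

definition mean_curvature_vector ::
  "('a, 'e::euclidean_space) metric_tensor \<Rightarrow> ('b, 'f::euclidean_space) metric_tensor \<Rightarrow>
   ('a \<Rightarrow> 'b) \<Rightarrow> ('a, 'e) chart \<Rightarrow> ('b, 'f) chart \<Rightarrow> 'a \<Rightarrow> 'f" where
  "mean_curvature_vector g h \<psi> c d p =
     (1 / real DIM('e)) *\<^sub>R metric_trace (g c (snd c p))
        (\<lambda>v w. second_fundamental_form (g c) (h d) (local_rep c d \<psi>)
                 (\<lambda>_. v) (\<lambda>_. w) (snd c p))"

section \<open>Plane fronted waves\<close>

definition pfw_chart ::
  "('m, 'e) chart \<Rightarrow> (real \<times> real \<times> 'm, real \<times> real \<times> 'e) chart" where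
  "pfw_chart c = (UNIV \<times> UNIV \<times> fst c, \<lambda>(u, v, x). (u, v, snd c x))"

definition pfw_atlas ::
  "('m, 'e) chart set \<Rightarrow> (real \<times> real \<times> 'm, real \<times> real \<times> 'e) chart set" where
  "pfw_atlas A = pfw_chart ` A"

lemma inj_pfw_chart: "inj pfw_chart"
proof (rule injI)
  fix c c' :: "('m, 'e) chart"
  assume eq: "pfw_chart c = pfw_chart c'"
  have "fst c = fst c'"
    using arg_cong[OF eq, of "\<lambda>d. (\<lambda>x. (0, 0, x)) -` fst d"] by (auto simp: pfw_chart_def)
  moreover have "snd c = snd c'"
    using arg_cong[OF eq, of "\<lambda>d x. snd (snd (snd d (0, 0, x)))"] by (auto simp: pfw_chart_def)
  ultimately show "c = c'" by (rule prod_eqI)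
qed

text \<open>
  The metric \<open>H du \<otimes> du + du \<otimes> dv + dv \<otimes> du + g\<close>.  The point has coordinates \<open>(u, v, y)\<close>, and
  \<open>inv pfw_chart d\<close> is the chart of \<open>M\<close> from which the product chart \<open>d\<close> was formed.  That
  \<open>H\<close> is independent of \<open>v\<close> is expressed by its type.
\<close>

definition pfw_metric ::
  "(real \<Rightarrow> 'm \<Rightarrow> real) \<Rightarrow> ('m, 'e) metric_tensor \<Rightarrow>
   (real \<times> real \<times> 'm, real \<times> real \<times> 'e) metric_tensor" where
  "pfw_metric H g d = (\<lambda>(u, v, y) (a, b, w) (a', b', w').
     (let c = inv pfw_chart d
      in H u (inv_into (fst c) (snd c) y) * a * a' + a * b' + b * a' + g c y w w'))"

lemma pfw_metric_pfw_chart: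
  "pfw_metric H g (pfw_chart c) (u, v, y) (a, b, w) (a', b', w') =
     H u (inv_into (fst c) (snd c) y) * a * a' + a * b' + b * a' + g c y w w'"
  by (simp add: pfw_metric_def inv_f_f[OF inj_pfw_chart])

text \<open>Components of the coordinate field \<open>\<partial>/\<partial>v\<close> in every product chart.\<close>

definition partial_v :: "real \<times> real \<times> 'e::zero" where
  "partial_v = (0, 1, 0)"

definition plane_fronted_wave ::
  "('m::{t2_space, second_countable_topology}, 'e::euclidean_space) chart set \<Rightarrow>
   ('m, 'e) metric_tensor \<Rightarrow> (real \<Rightarrow> 'm \<Rightarrow> real) \<Rightarrow> bool" where
  "plane_fronted_wave A g H \<longleftrightarrow> smooth_atlas A \<and> connected (UNIV :: 'm set) \<and>
     riemannian_metric A g \<and>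
     (\<forall>c\<in>A. smooth_on (UNIV \<times> snd c ` fst c) (\<lambda>(u, y). H u (inv_into (fst c) (snd c) y)))"

end

theory Submission
  imports Defs
begin

text \<open>
  Write \<open>\<mu> = u \<circ> \<psi>\<close>.  Since \<open>\<partial>\<^sub>v\<close> is parallel and \<open>\<langle>\<cdot>, \<partial>\<^sub>v\<rangle> = du\<close>, the Gauss formula gives
  \<open>\<Delta>\<mu> = k \<langle>H, \<partial>\<^sub>v\<rangle>\<close> on the submanifold.  If this is nonnegative, \<open>\<mu>\<close> is
  subharmonic; if it is nonpositive, \<open>-\<mu>\<close> is.  Both parts are thus instances of one statement on a
  complete connected Riemannian manifold: a subharmonic function \<open>f \<ge> u\<^sub>0\<close> that tends to \<open>u\<^sub>0\<close> at infinity is constant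
  equal to \<open>u\<^sub>0\<close> if the manifold is not compact (\<open>subharmonic_vanishing_at_infinity\<close>).

  If \<open>f p > u\<^sub>0\<close>, then \<open>f < f p\<close> outside some closed distance ball.  By the Hopf--Rinow theorem
  (\<open>hopf_rinow\<close>) this ball is compact, so \<open>f\<close> attains its global maximum.  The strong maximum
  principle (\<open>strong_maximum_principle_metric\<close>) makes the set of maximum points open; it is closed
  too, hence \<open>f\<close> is constant.  Then every point lies in the ball, and the manifold would be compact.

  The Hopf--Rinow theorem is derived from the theorem of Cohn-Vossen that a
  complete locally compact metric space in which distances are realised approximately by points
  in between has compact closed balls.  Its application requires that the Riemannian distance is a
  metric inducing the manifold topology.  Coordinate segments show that nearby points have small
  distance (\<open>short_curves_nearby\<close>); that a curve leaving a neighbourhood cannot be short is read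
  off from the drop of a \<open>C\<^sup>1\<close> bump function along it (\<open>curves_leaving_are_long\<close>).

  The maximum principle is proved in a chart, with Hopf's barrier \<open>exp (-\<alpha> |x - y|\<^sup>2)\<close>.  The Laplacian is
  used in the form of a trace over an orthonormal basis that is merely chosen pointwise, so its
  coefficients need not be continuous.  The barrier works because they are bounded on compact sets and
  uniformly elliptic there, by comparison of the metric with the Euclidean one and by a bound for the
  Christoffel symbols.

  In the wave, the parallelism of \<open>\<partial>\<^sub>v\<close> is used in the form that the Christoffel symbols have no
  \<open>u\<close>-component (\<open>christoffel_u_component\<close>).
\<close>

section \<open>Orthonormal frames of a scalar product\<close>

definition scalar_product :: "('e::euclidean_space \<Rightarrow> 'e \<Rightarrow> real) \<Rightarrow> bool" where
  "scalar_product G \<longleftrightarrow> bilinear G \<and> (\<forall>v w. G v w = G w v) \<and> (\<forall>v. v \<noteq> 0 \<longrightarrow> 0 < G v v)"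

lemma scalar_productD:
  assumes "scalar_product G"
  shows "bilinear G" "G v w = G w v" "v \<noteq> 0 \<Longrightarrow> 0 < G v v"
  using assms unfolding scalar_product_def by blast+

text \<open>
  The orthonormal basis over which \<open>metric_trace\<close> sums.
\<close>

definition frame :: "('e::euclidean_space \<Rightarrow> 'e \<Rightarrow> real) \<Rightarrow> 'e set" where
  "frame G = (SOME E. finite E \<and> card E = DIM('e) \<and>
                 (\<forall>e\<in>E. \<forall>f\<in>E. G e f = (if e = f then 1 else 0)))"

lemma metric_trace_frame: "metric_trace G B = (\<Sum>e\<in>frame G. B e e)"
  by (simp add: metric_trace_def frame_def Let_def)

lemma orthonormal_coeff:
  assumes "bilinear G" "finite E" "\<And>e f. e \<in> E \<Longrightarrow> f \<in> E \<Longrightarrow> G e f = (if e = f then 1 else 0)"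
    and "f \<in> E"
  shows "G (\<Sum>e\<in>E. a e *\<^sub>R e) f = (a f :: real)"
proof -
  have lin: "linear (\<lambda>x. G x f)" using assms(1) by (simp add: bilinear_def)
  have "G (\<Sum>e\<in>E. a e *\<^sub>R e) f = (\<Sum>e\<in>E. a e * G e f)"
    by (simp add: linear_sum[OF lin] bilinear_lmul[OF assms(1)])
  also have "\<dots> = (\<Sum>e\<in>E. if e = f then a f else 0)"
    using assms(3,4) by (intro sum.cong) auto
  finally show ?thesis using assms(2,4) by simp
qed

text \<open>
  Gram--Schmidt, one vector at a time: as long as the orthonormal set has fewer than \<open>DIM('e)\<close>
  elements it does not span, and the normal part of a vector outside its span can be added.
\<close>

lemma orthonormal_extend:
  fixes G :: "'e::euclidean_space \<Rightarrow> 'e \<Rightarrow> real"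
  assumes G: "scalar_product G"
    and m: "m \<le> DIM('e)"
  shows "\<exists>E. finite E \<and> card E = m \<and> (\<forall>e\<in>E. \<forall>f\<in>E. G e f = (if e = f then 1 else 0))"
  using m
proof (induction m)
  case 0 show ?case by (intro exI[of _ "{}"]) auto
next
  case (Suc m)
  note bil = scalar_productD(1)[OF G] and sym = scalar_productD(2)[OF G] and pos = scalar_productD(3)[OF G]
  from Suc obtain E where E: "finite E" "card E = m"
    and on: "\<And>e f. e \<in> E \<Longrightarrow> f \<in> E \<Longrightarrow> G e f = (if e = f then 1 else 0)" by auto
  have "dim (span E) < DIM('e)" using dim_le_card'[OF E(1)] E Suc.prems by (simp add: dim_span)
  then obtain z where z: "z \<notin> span E" by (metis UNIV_eq_I dim_UNIV less_irrefl)
  define y where "y = z - (\<Sum>e\<in>E. G z e *\<^sub>R e)"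
  have y0: "y \<noteq> 0"
  proof
    assume "y = 0"
    then have "z = (\<Sum>e\<in>E. G z e *\<^sub>R e)" by (simp add: y_def)
    also have "\<dots> \<in> span E" by (intro span_sum span_scale span_base)
    finally show False using z by simp
  qed
  have yE: "G y f = 0" if "f \<in> E" for f
    using orthonormal_coeff[OF bil E(1) on that, of "G z"] by (simp add: y_def bilinear_lsub[OF bil])
  define n where "n = (1 / sqrt (G y y)) *\<^sub>R y"
  have nn: "G n n = 1" using pos[OF y0]
    by (simp add: n_def bilinear_lmul[OF bil] bilinear_rmul[OF bil] field_simps)
  have nE: "G n f = 0" "G f n = 0" if "f \<in> E" for f
    using yE[OF that] sym[of f n] by (simp_all add: n_def bilinear_lmul[OF bil])
  then have "n \<notin> E" using nn by fastforce
  then show ?case using E on nn nE by (intro exI[of _ "insert n E"]) auto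
qed

lemma frame_orthonormal:
  fixes G :: "'e::euclidean_space \<Rightarrow> 'e \<Rightarrow> real"
  assumes G: "scalar_product G"
  shows "finite (frame G)" "card (frame G) = DIM('e)"
    and "\<And>e f. e \<in> frame G \<Longrightarrow> f \<in> frame G \<Longrightarrow> G e f = (if e = f then 1 else 0)"
proof -
  have "finite (frame G) \<and> card (frame G) = DIM('e) \<and>
      (\<forall>e\<in>frame G. \<forall>f\<in>frame G. G e f = (if e = f then 1 else 0))"
    unfolding frame_def by (rule someI_ex[OF orthonormal_extend[OF G order.refl]])
  then show "finite (frame G)" "card (frame G) = DIM('e)"
    "\<And>e f. e \<in> frame G \<Longrightarrow> f \<in> frame G \<Longrightarrow> G e f = (if e = f then 1 else 0)" by simp_all
qed

lemma frame_expand: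
  fixes G :: "'e::euclidean_space \<Rightarrow> 'e \<Rightarrow> real"
  assumes G: "scalar_product G"
  shows "z = (\<Sum>e\<in>frame G. G z e *\<^sub>R e)"
proof -
  note F = frame_orthonormal[OF G] and bil = scalar_productD(1)[OF G]
  have "independent (frame G)"
  proof (rule independent_if_scalars_zero[OF F(1)])
    fix c e assume "(\<Sum>v\<in>frame G. c v *\<^sub>R v) = 0" and e: "e \<in> frame G"
    then show "c e = 0"
      using orthonormal_coeff[OF bil F(1) F(3) e, of c] by (simp add: bilinear_lzero[OF bil])
  qed
  then have "UNIV \<subseteq> span (frame G)"
    by (intro card_ge_dim_independent) (auto simp: F)
  then have "z \<in> span (frame G)" by blast
  then obtain a where a: "z = (\<Sum>e\<in>frame G. a e *\<^sub>R e)"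
    by (auto simp: span_finite[OF F(1)])
  have "G z e = a e" if "e \<in> frame G" for e
    unfolding a by (rule orthonormal_coeff[OF bil F(1) F(3) that])
  then show ?thesis using a by simp
qed

text \<open>
  Uniform ellipticity of the trace.  Expand one factor of \<open>z \<bullet> z\<close> in the frame and apply the
  Cauchy--Schwarz inequality; the coefficients satisfy \<open>\<Sum>e. (G z e)\<^sup>2 = G z z \<le> L |z|\<^sup>2\<close>.
\<close>

lemma frame_elliptic:
  fixes G :: "'e::euclidean_space \<Rightarrow> 'e \<Rightarrow> real"
  assumes G: "scalar_product G"
    and up: "\<And>v. G v v \<le> L * (norm v)\<^sup>2"
  shows "(norm z)\<^sup>2 \<le> L * (\<Sum>e\<in>frame G. (z \<bullet> e)\<^sup>2)"
proof (cases "z = 0")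
  case False
  note bil = scalar_productD(1)[OF G]
  have ex: "z = (\<Sum>e\<in>frame G. G z e *\<^sub>R e)" by (rule frame_expand[OF G])
  have "G z z = (\<Sum>e\<in>frame G. (G z e)\<^sup>2)"
  proof -
    have lin: "linear (G z)" using bil by (simp add: bilinear_def)
    have "G z z = G z (\<Sum>e\<in>frame G. G z e *\<^sub>R e)" using ex by simp
    also have "\<dots> = (\<Sum>e\<in>frame G. (G z e)\<^sup>2)"
      by (simp add: linear_sum[OF lin] linear_scale[OF lin] power2_eq_square)
    finally show ?thesis .
  qed
  moreover have "z \<bullet> z = (\<Sum>e\<in>frame G. G z e * (z \<bullet> e))"
  proof -
    have "z \<bullet> z = z \<bullet> (\<Sum>e\<in>frame G. G z e *\<^sub>R e)" using ex by simp
    then show ?thesis by (simp add: inner_sum_right)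
  qed
  moreover have "(\<Sum>e\<in>frame G. G z e * (z \<bullet> e))\<^sup>2 \<le> (\<Sum>e\<in>frame G. (G z e)\<^sup>2) * (\<Sum>e\<in>frame G. (z \<bullet> e)\<^sup>2)"
    by (rule Cauchy_Schwarz_ineq_sum)
  ultimately have "((norm z)\<^sup>2)\<^sup>2 \<le> G z z * (\<Sum>e\<in>frame G. (z \<bullet> e)\<^sup>2)"
    by (simp add: power2_norm_eq_inner)
  also have "\<dots> \<le> (L * (norm z)\<^sup>2) * (\<Sum>e\<in>frame G. (z \<bullet> e)\<^sup>2)"
    by (intro mult_right_mono up sum_nonneg) auto
  finally have "(norm z)\<^sup>2 * (norm z)\<^sup>2 \<le> (norm z)\<^sup>2 * (L * (\<Sum>e\<in>frame G. (z \<bullet> e)\<^sup>2))"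
    by (simp add: power2_eq_square algebra_simps)
  then show ?thesis using False by (subst (asm) mult_le_cancel_left_pos) auto
qed (simp add: sum_nonneg)

section \<open>The strong maximum principle\<close>

text \<open>
  Only the restriction of \<open>h\<close> to the line through \<open>x\<close> in direction \<open>v\<close> matters: if its second
  derivative were positive, its first derivative would be positive just after \<open>x\<close>.
\<close>

lemma second_derivative_test:
  fixes h :: "'e::euclidean_space \<Rightarrow> real"
  assumes S: "open S" "x \<in> S" and h1: "\<And>y. y \<in> S \<Longrightarrow> (h has_derivative H1 y) (at y)"
    and h2: "((\<lambda>y. H1 y v) has_derivative H2) (at x)"
    and max: "\<And>y. y \<in> S \<Longrightarrow> h y \<le> h x"
  shows "H1 x = (\<lambda>_. 0)" "H2 v \<le> 0"
proof -
  show z: "H1 x = (\<lambda>_. 0)"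
    by (rule differential_zero_maxmin[OF S(2,1) h1[OF S(2)]]) (use max in auto)
  show "H2 v \<le> 0"
  proof (rule ccontr)
    assume "\<not> H2 v \<le> 0"
    then have p: "0 < H2 v" by simp
    obtain r where r: "0 < r" "ball x r \<subseteq> S" using S openE by blast
    define \<delta> where "\<delta> = r / (norm v + 1)"
    have d0: "0 < \<delta>" unfolding \<delta>_def using r by (intro divide_pos_pos) (auto simp: add_nonneg_pos)
    have inS: "x + t *\<^sub>R v \<in> S" if "0 \<le> t" "t < \<delta>" for t
    proof -
      have "t * norm v \<le> t * (norm v + 1)" using that by (intro mult_left_mono) auto
      also have "\<dots> < r" using that unfolding \<delta>_def by (simp add: pos_less_divide_eq add_nonneg_pos)
      finally show ?thesis using r that by (auto simp: subset_iff dist_norm)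
    qed
    have line: "((\<lambda>t. x + t *\<^sub>R v) has_derivative (\<lambda>s. s *\<^sub>R v)) (at t)" for t
      by (auto intro!: derivative_eq_intros)
    have "((\<lambda>t. H1 (x + t *\<^sub>R v) v) has_derivative (\<lambda>s. H2 (s *\<^sub>R v))) (at 0)"
      by (rule has_derivative_compose[OF line[of 0], where g = "\<lambda>y. H1 y v" and g' = H2])
        (use h2 in simp)
    moreover have "(\<lambda>s. H2 (s *\<^sub>R v)) = (*) (H2 v)"
      using linear_scale[OF has_derivative_linear[OF h2]] by (simp add: fun_eq_iff)
    ultimately have "((\<lambda>t. H1 (x + t *\<^sub>R v) v) has_real_derivative H2 v) (at 0)"
      unfolding has_field_derivative_def by metis
    from DERIV_pos_inc_right[OF this p] obtain d where d: "0 < d"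
      "\<And>t. 0 < t \<Longrightarrow> t < d \<Longrightarrow> 0 < H1 (x + t *\<^sub>R v) v" by (auto simp: z)
    define t where "t = min d \<delta> / 2"
    have t: "0 < t" "t < d" "t < \<delta>" using d d0 by (auto simp: t_def)
    have "h (x + 0 *\<^sub>R v) < h (x + t *\<^sub>R v)"
    proof (rule DERIV_pos_imp_increasing_open[OF t(1)])
      have der: "((\<lambda>t. h (x + t *\<^sub>R v)) has_real_derivative H1 (x + s *\<^sub>R v) v) (at s)"
        if "0 \<le> s" "s \<le> t" for s
      proof -
        have i: "x + s *\<^sub>R v \<in> S" using inS that t by simp
        have "((\<lambda>t. h (x + t *\<^sub>R v)) has_derivative (\<lambda>u. H1 (x + s *\<^sub>R v) (u *\<^sub>R v))) (at s)"
          by (rule has_derivative_compose[OF line, where g = h and g' = "H1 (x + s *\<^sub>R v)"]) (rule h1[OF i])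
        moreover have "(\<lambda>u. H1 (x + s *\<^sub>R v) (u *\<^sub>R v)) = (*) (H1 (x + s *\<^sub>R v) v)"
          using linear_scale[OF has_derivative_linear[OF h1[OF i]]] by (simp add: fun_eq_iff)
        ultimately show ?thesis unfolding has_field_derivative_def by metis
      qed
      show "\<exists>y. ((\<lambda>t. h (x + t *\<^sub>R v)) has_real_derivative y) (at s) \<and> 0 < y" if "0 < s" "s < t" for s
        using der[of s] d(2)[of s] that t by auto
      show "continuous_on {0..t} (\<lambda>t. h (x + t *\<^sub>R v))"
        by (rule DERIV_continuous_on[OF has_field_derivative_at_within[OF der]]) auto
    qed
    moreover have "h (x + t *\<^sub>R v) \<le> h x" using max inS t by simp
    ultimately show False by simp
  qed
qed

text \<open>
  Hopf's argument for the operator \<open>f \<mapsto> (\<Sum>e\<in>E x. D\<^sup>2f(e, e)) - Df(b x)\<close>.  If \<open>f\<close> is not equal to \<open>M\<close>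
  near \<open>p\<close>, there is a ball that touches the set \<open>f = M\<close> in exactly one point \<open>x\<^sub>0\<close> and contains no
  other point of it.  With \<open>y\<close> and \<open>R\<close> its centre and radius, the barrier
  \<open>w = exp (-\<alpha> |x - y|\<^sup>2) - exp (-\<alpha> R\<^sup>2)\<close> is strictly subharmonic near \<open>x\<^sub>0\<close> for large \<open>\<alpha>\<close>, vanishes at
  \<open>x\<^sub>0\<close>, and is negative outside the ball.  Hence for small \<open>\<epsilon>\<close> the strictly subharmonic function
  \<open>f + \<epsilon> w\<close> has an interior maximum in a small ball around \<open>x\<^sub>0\<close>, which the second derivative test
  forbids.
\<close>

lemma strong_maximum_principle:
  fixes f :: "'e::euclidean_space \<Rightarrow> real" and b :: "'e \<Rightarrow> 'e" and E :: "'e \<Rightarrow> 'e set"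
  assumes S: "open S" and p: "p \<in> S"
    and D1: "\<And>x. x \<in> S \<Longrightarrow> (f has_derivative D1 x) (at x)"
    and D2: "\<And>x w. x \<in> S \<Longrightarrow> ((\<lambda>y. D1 y w) has_derivative (\<lambda>v. D2 x v w)) (at x)"
    and sub: "\<And>x. x \<in> S \<Longrightarrow> 0 \<le> (\<Sum>e\<in>E x. D2 x e e) - D1 x (b x)"
    and bounds: "\<And>K. compact K \<Longrightarrow> K \<subseteq> S \<Longrightarrow> \<exists>c C. 0 < c \<and>
        (\<forall>x\<in>K. (\<forall>z. c * (norm z)\<^sup>2 \<le> (\<Sum>e\<in>E x. (z \<bullet> e)\<^sup>2)) \<and>
               (\<Sum>e\<in>E x. (norm e)\<^sup>2) \<le> C \<and> norm (b x) \<le> C)"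
    and le: "\<And>x. x \<in> S \<Longrightarrow> f x \<le> M" and fp: "f p = M"
  shows "\<exists>\<rho>>0. \<forall>x\<in>ball p \<rho>. f x = M"
proof (rule ccontr)
  assume not: "\<not> ?thesis"
  obtain r where r: "0 < r" "cball p (2 * r) \<subseteq> S"
  proof -
    obtain e where "0 < e" "cball p e \<subseteq> S" using open_contains_cball S p by blast
    then show ?thesis using that[of "e/2"] by simp
  qed
  have cf: "continuous_on S f"
    using D1 by (meson continuous_at_imp_continuous_on has_derivative_continuous)
  obtain q where q: "q \<in> ball p r" "f q \<noteq> M" using not r(1) by blast
  define Z where "Z = {x \<in> cball p (2 * r). f x = M}"
  have cZ: "compact Z"
  proof -
    have "closed Z" unfolding Z_def
      by (intro continuous_closed_preimage_constant continuous_on_subset[OF cf] r) auto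
    moreover have "bounded Z" unfolding Z_def by (rule bounded_subset[OF bounded_cball[of p "2*r"]]) auto
    ultimately show ?thesis by (simp add: compact_eq_bounded_closed)
  qed
  have pZ: "p \<in> Z" using r fp by (simp add: Z_def)
  obtain x0 where x0: "x0 \<in> Z" and near: "\<And>x. x \<in> Z \<Longrightarrow> dist q x0 \<le> dist q x"
    using distance_attains_inf[of Z q] cZ pZ compact_imp_closed by auto
  have "q \<noteq> x0" using x0 q by (auto simp: Z_def)
  then have R: "0 < dist q x0" by simp
  have Rr: "dist q x0 < r" using near[OF pZ] q(1) by (simp add: dist_commute)
  have x0p: "dist p x0 < 2 * r" using dist_triangle[of p x0 q] Rr q(1) by simp
  have x0S: "x0 \<in> S" and fx0: "f x0 = M" using x0 r(2) by (auto simp: Z_def)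
  have less: "f x < M" if "dist q x < dist q x0" for x
  proof -
    have "dist p x < 2 * r" using dist_triangle[of p x q] that Rr q(1) by simp
    then have xc: "x \<in> cball p (2 * r)" by simp
    then have "f x \<noteq> M" using near[of x] that by (auto simp: Z_def)
    moreover have "f x \<le> M" using le xc r(2) by blast
    ultimately show ?thesis by simp
  qed
  \<comment> \<open>The ball around \<open>q\<close> may touch \<open>Z\<close> in many points; halving it towards \<open>x0\<close> leaves only
    \<open>x0\<close>, because equality in the triangle inequality forces collinearity.\<close>
  define y where "y = midpoint q x0"
  define R where "R = dist q x0 / 2"
  have R0: "0 < R" using R by (simp add: R_def)
  have yx0: "dist y x0 = R" and yq: "dist q y = R"
    unfolding y_def R_def by (simp_all add: dist_midpoint)
  have touch: "f x < M" if "dist y x \<le> R" "x \<noteq> x0" for x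
  proof (rule less, rule ccontr)
    assume "\<not> dist q x < dist q x0"
    then have ge: "norm (x - y) + norm (y - q) \<le> norm ((x - y) + (y - q))"
      using that(1) yq by (simp add: R_def dist_norm norm_minus_commute)
    then have eq: "norm ((x - y) + (y - q)) = norm (x - y) + norm (y - q)"
      using norm_triangle_ineq[of "x - y" "y - q"] by linarith
    have n1: "norm (y - q) = R" using yq by (simp add: dist_norm norm_minus_commute)
    have "norm (x - y) = R"
    proof -
      have "2 * R \<le> norm ((x - y) + (y - q))"
        using \<open>\<not> dist q x < dist q x0\<close> by (simp add: R_def dist_norm norm_minus_commute)
      then show ?thesis using eq n1 that(1) by (simp add: dist_norm norm_minus_commute)
    qed
    with eq n1 have "R *\<^sub>R (y - q) = R *\<^sub>R (x - y)" using norm_triangle_eq by metis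
    then have "y - q = x - y" using R0 by simp
    moreover have "y - q = x0 - y" unfolding y_def midpoint_def
      by (simp add: algebra_simps flip: scaleR_add_left)
    ultimately show False using that(2) by simp
  qed
  obtain \<rho> where \<rho>: "0 < \<rho>" "\<rho> \<le> R / 2" "cball x0 \<rho> \<subseteq> S"
  proof -
    obtain e where "0 < e" "cball x0 e \<subseteq> S" using open_contains_cball S x0S by blast
    moreover have "cball x0 (min e (R/2)) \<subseteq> cball x0 e" by auto
    ultimately show ?thesis using that[of "min e (R/2)"] R0 by auto
  qed
  let ?K = "cball x0 \<rho>"
  obtain c C where c: "0 < c"
    and ell: "\<And>x z. x \<in> ?K \<Longrightarrow> c * (norm z)\<^sup>2 \<le> (\<Sum>e\<in>E x. (z \<bullet> e)\<^sup>2)"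
    and C: "\<And>x. x \<in> ?K \<Longrightarrow> (\<Sum>e\<in>E x. (norm e)\<^sup>2) \<le> C" "\<And>x. x \<in> ?K \<Longrightarrow> norm (b x) \<le> C"
    using bounds[OF compact_cball \<rho>(3)] by blast
  have C0: "0 \<le> C" using C(2)[of x0] \<rho>(1) norm_ge_zero[of "b x0"] by (simp del: norm_ge_zero)
  have range: "R / 2 \<le> norm (x - y)" "norm (x - y) \<le> 2 * R" if "x \<in> ?K" for x
  proof -
    have "dist x0 x \<le> R / 2" using that \<rho> by simp
    then show "R / 2 \<le> norm (x - y)" "norm (x - y) \<le> 2 * R"
      using dist_triangle[of y x0 x] dist_triangle[of y x x0] yx0 R0
      by (auto simp: dist_norm norm_minus_commute)
  qed
  \<comment> \<open>Chosen so that \<open>2 \<alpha> c (R / 2)\<^sup>2\<close> exceeds \<open>C + 2 R C\<close>, a bound for the terms of lower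
    order in \<open>\<alpha>\<close>.\<close>
  define \<alpha> where "\<alpha> = (2 * C + 4 * R * C + 1) / (c * R\<^sup>2)"
  have \<alpha>0: "0 < \<alpha>" unfolding \<alpha>_def using c C0 R0
    by (intro divide_pos_pos) (auto intro!: add_nonneg_pos add_nonneg_nonneg)
  define w where "w x = exp (- \<alpha> * ((x - y) \<bullet> (x - y))) - exp (- \<alpha> * R\<^sup>2)" for x
  define W1 where "W1 x v = - 2 * \<alpha> * ((x - y) \<bullet> v) * exp (- \<alpha> * ((x - y) \<bullet> (x - y)))" for x v
  define W2 where "W2 x u v = (4 * \<alpha>\<^sup>2 * ((x - y) \<bullet> u) * ((x - y) \<bullet> v) - 2 * \<alpha> * (u \<bullet> v)) *
      exp (- \<alpha> * ((x - y) \<bullet> (x - y)))" for x u v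
  have dw1: "(w has_derivative W1 x) (at x)" for x
    unfolding w_def W1_def
    by (auto intro!: derivative_eq_intros simp: fun_eq_iff inner_commute algebra_simps)
  have dw2: "((\<lambda>x. W1 x v) has_derivative (\<lambda>u. W2 x u v)) (at x)" for x v
    unfolding W1_def W2_def
    by (auto intro!: derivative_eq_intros simp: fun_eq_iff inner_commute power2_eq_square algebra_simps)
  have Lw: "0 < (\<Sum>e\<in>E x. W2 x e e) - W1 x (b x)" if x: "x \<in> ?K" for x
  proof -
    let ?e = "exp (- \<alpha> * ((x - y) \<bullet> (x - y)))"
    have "(\<Sum>e\<in>E x. W2 x e e) - W1 x (b x) =
      2 * \<alpha> * ?e * (2 * \<alpha> * (\<Sum>e\<in>E x. ((x - y) \<bullet> e)\<^sup>2) - (\<Sum>e\<in>E x. (norm e)\<^sup>2) + (x - y) \<bullet> b x)"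
      by (simp add: W1_def W2_def sum_distrib_left sum_distrib_right sum_subtractf sum.distrib power2_eq_square
          algebra_simps flip: power2_norm_eq_inner)
    moreover have "0 < 2 * \<alpha> * (\<Sum>e\<in>E x. ((x - y) \<bullet> e)\<^sup>2) - (\<Sum>e\<in>E x. (norm e)\<^sup>2) + (x - y) \<bullet> b x"
    proof -
      have "(R / 2)\<^sup>2 \<le> (norm (x - y))\<^sup>2" using range(1)[OF x] R0 by (intro power_mono) auto
      then have "c * (R / 2)\<^sup>2 \<le> (\<Sum>e\<in>E x. ((x - y) \<bullet> e)\<^sup>2)"
        using ell[OF x, of "x - y"] c by (meson mult_left_mono less_imp_le order_trans)
      then have "2 * \<alpha> * (c * (R / 2)\<^sup>2) \<le> 2 * \<alpha> * (\<Sum>e\<in>E x. ((x - y) \<bullet> e)\<^sup>2)"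
        using \<alpha>0 by (intro mult_left_mono) auto
      moreover have "2 * \<alpha> * (c * (R / 2)\<^sup>2) = (2 * C + 4 * R * C + 1) / 2"
        using c R0 by (simp add: \<alpha>_def power2_eq_square field_simps)
      moreover have "\<bar>(x - y) \<bullet> b x\<bar> \<le> (2 * R) * C"
        by (rule order_trans[OF Cauchy_Schwarz_ineq2]) (use range[OF x] C(2)[OF x] R0 in \<open>auto intro: mult_mono\<close>)
      ultimately show ?thesis using C(1)[OF x] by (simp add: field_simps)
    qed
    ultimately show ?thesis using \<alpha>0 by simp
  qed
  define T where "T = sphere x0 \<rho> \<inter> cball y R"
  obtain \<delta> where \<delta>: "0 < \<delta>" "\<And>x. x \<in> T \<Longrightarrow> f x \<le> M - \<delta>"
  proof (cases "T = {}")
    case True then show ?thesis using that[of 1] by auto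
  next
    case False
    have "compact T" unfolding T_def by (intro compact_Int_closed compact_sphere closed_cball)
    moreover have "continuous_on T f" by (rule continuous_on_subset[OF cf]) (use \<rho>(3) in \<open>auto simp: T_def\<close>)
    ultimately obtain t where t: "t \<in> T" "\<And>x. x \<in> T \<Longrightarrow> f x \<le> f t"
      using continuous_attains_sup[OF _ False] by blast
    have "t \<noteq> x0" using t(1) \<rho>(1) by (auto simp: T_def)
    then have "f t < M" using touch[of t] t(1) by (auto simp: T_def)
    then show ?thesis using that[of "M - f t"] t(2) by auto
  qed
  define \<epsilon> where "\<epsilon> = \<delta> / 2"
  have \<epsilon>0: "0 < \<epsilon>" using \<delta> by (simp add: \<epsilon>_def)
  define h where "h x = f x + \<epsilon> * w x" for x
  have wle: "w x \<le> 1" for x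
  proof -
    have "exp (- \<alpha> * ((x - y) \<bullet> (x - y))) \<le> 1" using \<alpha>0 by simp
    then show ?thesis unfolding w_def using exp_gt_zero[of "- \<alpha> * R\<^sup>2"] by linarith
  qed
  have hsph: "h x < M" if "x \<in> sphere x0 \<rho>" for x
  proof (cases "x \<in> cball y R")
    case True
    then have "f x \<le> M - \<delta>" using \<delta>(2) that by (simp add: T_def)
    moreover have "\<epsilon> * w x \<le> \<epsilon>" using mult_left_mono[OF wle, of \<epsilon> x] \<epsilon>0 by simp
    moreover have "\<epsilon> < \<delta>" using \<delta>(1) by (simp add: \<epsilon>_def)
    ultimately show ?thesis unfolding h_def by linarith
  next
    case False
    then have "R < norm (x - y)" by (simp add: dist_norm norm_minus_commute)
    then have "R\<^sup>2 < (norm (x - y))\<^sup>2" using R0 by (intro power_strict_mono) auto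
    then have "w x < 0" unfolding w_def using \<alpha>0 by (simp add: power2_norm_eq_inner)
    then have "\<epsilon> * w x < 0" using \<epsilon>0 by (simp add: mult_pos_neg)
    moreover have "f x \<le> M" using le \<rho>(3) that by auto
    ultimately show ?thesis by (simp add: h_def)
  qed
  have hx0: "h x0 = M"
  proof -
    have "(norm (x0 - y))\<^sup>2 = R\<^sup>2" using yx0 by (simp add: dist_norm norm_minus_commute)
    then show ?thesis by (simp add: h_def w_def fx0 power2_norm_eq_inner)
  qed
  define H1 where "H1 x v = D1 x v + \<epsilon> * W1 x v" for x v
  define H2 where "H2 x u v = D2 x u v + \<epsilon> * W2 x u v" for x u v
  have dh1: "(h has_derivative H1 x) (at x)" if "x \<in> S" for x
    unfolding h_def H1_def using D1[OF that] dw1 by (intro has_derivative_add has_derivative_mult_right)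
  have dh2: "((\<lambda>x. H1 x v) has_derivative (\<lambda>u. H2 x u v)) (at x)" if "x \<in> S" for x v
    unfolding H1_def H2_def using D2[OF that] dw2 by (intro has_derivative_add has_derivative_mult_right)
  have "continuous_on ?K h"
    using dh1 \<rho>(3) by (meson continuous_at_imp_continuous_on has_derivative_continuous subsetD)
  then obtain x1 where x1: "x1 \<in> ?K" "\<And>x. x \<in> ?K \<Longrightarrow> h x \<le> h x1"
    using continuous_attains_sup[OF compact_cball, of x0 \<rho> h] \<rho>(1) by auto
  have "M \<le> h x1" using x1(2)[of x0] hx0 \<rho>(1) by simp
  then have "x1 \<notin> sphere x0 \<rho>" using hsph by fastforce
  then have x1b: "x1 \<in> ball x0 \<rho>" using x1(1) by (auto simp: less_le)
  have x1S: "x1 \<in> S" using x1(1) \<rho>(3) by blast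
  have bS: "x \<in> S" if "x \<in> ball x0 \<rho>" for x using that \<rho>(3) by auto
  have bmax: "h x \<le> h x1" if "x \<in> ball x0 \<rho>" for x using x1(2) that by auto
  note test = second_derivative_test[OF open_ball x1b, where h = h and ?H1.0 = H1,
      OF dh1[OF bS] dh2[OF x1S] bmax]
  have "(\<Sum>e\<in>E x1. H2 x1 e e) - H1 x1 (b x1) \<le> 0"
    using test by (simp add: sum_nonpos)
  moreover have "(\<Sum>e\<in>E x1. H2 x1 e e) - H1 x1 (b x1) =
      ((\<Sum>e\<in>E x1. D2 x1 e e) - D1 x1 (b x1)) + \<epsilon> * ((\<Sum>e\<in>E x1. W2 x1 e e) - W1 x1 (b x1))"
    by (simp add: H1_def H2_def sum.distrib sum_distrib_left algebra_simps)
  ultimately show False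
    using sub[OF x1S] mult_pos_pos[OF \<epsilon>0 Lw[OF x1(1)]] by linarith
qed

section \<open>The maximum principle for the Laplacian in a chart\<close>

lemma bilinear_expand:
  fixes G :: "'e::euclidean_space \<Rightarrow> 'e \<Rightarrow> real"
  assumes "bilinear G"
  shows "G v w = (\<Sum>i\<in>Basis. \<Sum>j\<in>Basis. (v \<bullet> i) * (w \<bullet> j) * G i j)"
proof -
  have "G v w = G (\<Sum>i\<in>Basis. (v \<bullet> i) *\<^sub>R i) (\<Sum>j\<in>Basis. (w \<bullet> j) *\<^sub>R j)"
    by (simp only: euclidean_representation)
  also have "\<dots> = (\<Sum>i\<in>Basis. \<Sum>j\<in>Basis. (v \<bullet> i) * (w \<bullet> j) * G i j)"
    by (subst bilinear_sum[OF assms])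
      (simp_all add: sum.cartesian_product bilinear_lmul[OF assms] bilinear_rmul[OF assms] ac_simps)
  finally show ?thesis .
qed

lemma continuous_on_metric:
  fixes G :: "'e::euclidean_space \<Rightarrow> 'e \<Rightarrow> 'e \<Rightarrow> real"
  assumes "\<And>x. x \<in> S \<Longrightarrow> bilinear (G x)" and "\<And>v w. continuous_on S (\<lambda>x. G x v w)"
    and "continuous_on T x" "x ` T \<subseteq> S" "continuous_on T V" "continuous_on T W"
  shows "continuous_on T (\<lambda>t. G (x t) (V t) (W t))"
proof -
  have "continuous_on T (\<lambda>t. \<Sum>i\<in>Basis. \<Sum>j\<in>Basis. (V t \<bullet> i) * (W t \<bullet> j) * G (x t) i j)"
    by (intro continuous_intros assms continuous_on_compose2[OF assms(2,3,4)])
  moreover have "G (x t) (V t) (W t) = (\<Sum>i\<in>Basis. \<Sum>j\<in>Basis. (V t \<bullet> i) * (W t \<bullet> j) * G (x t) i j)"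
    if "t \<in> T" for t
    using assms(1,4) that by (intro bilinear_expand) auto
  ultimately show ?thesis by (simp cong: continuous_on_cong)
qed

text \<open>
  Minimum and maximum over the compact set of Euclidean unit vectors at points of \<open>K\<close>, extended to
  all vectors by homogeneity.
\<close>

lemma metric_bounds:
  fixes G :: "'e::euclidean_space \<Rightarrow> 'e \<Rightarrow> 'e \<Rightarrow> real"
  assumes K: "compact K" and bil: "\<And>x. x \<in> K \<Longrightarrow> bilinear (G x)"
    and pos: "\<And>x v. x \<in> K \<Longrightarrow> v \<noteq> 0 \<Longrightarrow> 0 < G x v v"
    and cont: "\<And>v w. continuous_on K (\<lambda>x. G x v w)"
  obtains l L where "0 < l" "0 < L"
    "\<And>x v. x \<in> K \<Longrightarrow> l * (norm v)\<^sup>2 \<le> G x v v" "\<And>x v. x \<in> K \<Longrightarrow> G x v v \<le> L * (norm v)\<^sup>2"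
proof (cases "K = {}")
  case True then show ?thesis using that[of 1 1] by auto
next
  case False
  let ?T = "K \<times> sphere (0::'e) 1"
  have T: "compact ?T" "?T \<noteq> {}"
    using K False by (auto simp: compact_Times)
  have c: "continuous_on ?T (\<lambda>z. G (fst z) (snd z) (snd z))"
    by (rule continuous_on_metric[OF bil cont]) (auto intro: continuous_intros)
  obtain m where m: "m \<in> ?T" "\<And>z. z \<in> ?T \<Longrightarrow> G (fst m) (snd m) (snd m) \<le> G (fst z) (snd z) (snd z)"
    using continuous_attains_inf[OF T c] by blast
  obtain n where n: "n \<in> ?T" "\<And>z. z \<in> ?T \<Longrightarrow> G (fst z) (snd z) (snd z) \<le> G (fst n) (snd n) (snd n)"
    using continuous_attains_sup[OF T c] by blast
  have scale: "G x v v = (norm v)\<^sup>2 * G x (v /\<^sub>R norm v) (v /\<^sub>R norm v)" if "x \<in> K" "v \<noteq> 0" for x v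
    using that by (simp add: bilinear_lmul[OF bil] bilinear_rmul[OF bil] power2_eq_square field_simps)
  have zero: "G x 0 0 = 0" if "x \<in> K" for x using bilinear_lzero[OF bil[OF that]] by simp
  show ?thesis
  proof (rule that)
    show "0 < G (fst m) (snd m) (snd m)" "0 < G (fst n) (snd n) (snd n)" using m n by (auto intro!: pos)
    fix x v assume x: "x \<in> K"
    show "G (fst m) (snd m) (snd m) * (norm v)\<^sup>2 \<le> G x v v"
    proof (cases "v = 0")
      case False
      then show ?thesis
        unfolding scale[OF x False] using m(2)[of "(x, v /\<^sub>R norm v)"] x by (auto simp: mult.commute[of _ "(norm v)\<^sup>2"])
    qed (simp add: zero x)
    show "G x v v \<le> G (fst n) (snd n) (snd n) * (norm v)\<^sup>2"
    proof (cases "v = 0")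
      case False
      then show ?thesis
        unfolding scale[OF x False] using n(2)[of "(x, v /\<^sub>R norm v)"] x by (auto simp: mult.commute[of _ "(norm v)\<^sup>2"])
    qed (simp add: zero x)
  qed
qed

text \<open>
  The coordinate form of a Riemannian metric; class \<open>C\<^sup>1\<close> makes its Christoffel symbols locally bounded.
\<close>

definition metric_field :: "'e::euclidean_space set \<Rightarrow> ('e \<Rightarrow> 'e \<Rightarrow> 'e \<Rightarrow> real) \<Rightarrow> bool" where
  "metric_field S G \<longleftrightarrow> open S \<and>
     (\<forall>x\<in>S. scalar_product (G x)) \<and>
     (\<forall>v w. Ck_on 1 S (\<lambda>x. G x v w))"

lemma metric_fieldD:
  assumes "metric_field S G"
  shows "open S" "\<And>x. x \<in> S \<Longrightarrow> bilinear (G x)" "\<And>x v w. x \<in> S \<Longrightarrow> G x v w = G x w v"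
    "\<And>x v. x \<in> S \<Longrightarrow> v \<noteq> 0 \<Longrightarrow> 0 < G x v v"
    "\<And>x v w. x \<in> S \<Longrightarrow> (\<lambda>y. G y v w) differentiable (at x)"
    "\<And>u v w. continuous_on S (\<lambda>x. frechet_derivative (\<lambda>y. G y v w) (at x) u)"
    "\<And>v w. continuous_on S (\<lambda>x. G x v w)"
proof -
  show d: "\<And>x v w. x \<in> S \<Longrightarrow> (\<lambda>y. G y v w) differentiable (at x)"
    using assms by (simp add: metric_field_def)
  show "\<And>v w. continuous_on S (\<lambda>x. G x v w)"
    using d by (meson continuous_at_imp_continuous_on differentiable_imp_continuous_within)
qed (use assms in \<open>auto simp: metric_field_def scalar_product_def\<close>)

lemma metric_field_subset:
  assumes "metric_field T G" "open S" "S \<subseteq> T"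
  shows "metric_field S G"
proof -
  have "Ck_on 1 S (\<lambda>x. G x v w)" for v w
    using metric_fieldD(5)[OF assms(1)] assms(3)
      continuous_on_subset[OF metric_fieldD(6)[OF assms(1), of v w] assms(3)] by auto
  then show ?thesis using assms unfolding metric_field_def by blast
qed

lemma metric_field_bounds:
  assumes G: "metric_field S G" and K: "compact K" "K \<subseteq> S"
  obtains l L where "0 < l" "0 < L"
    "\<And>x v. x \<in> K \<Longrightarrow> l * (norm v)\<^sup>2 \<le> G x v v" "\<And>x v. x \<in> K \<Longrightarrow> G x v v \<le> L * (norm v)\<^sup>2"
proof (rule metric_bounds[OF K(1), of G])
  show "continuous_on K (\<lambda>x. G x v w)" for v w
    by (rule continuous_on_subset[OF metric_fieldD(7)[OF G] K(2)])
qed (use metric_fieldD(2,4)[OF G] K(2) that in blast)+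

lemma levi_civita_christoffel:
  assumes G: "metric_field S G" and x: "x \<in> S"
  shows "levi_civita_at G x (christoffel G x)"
  unfolding christoffel_def
proof (rule theI'[OF levi_civita_at_ex1])
  show "v = 0" if "\<And>w. G x v w = 0" for v
    using metric_fieldD(4)[OF G x, of v] that[of v] by force
qed (use metric_fieldD[OF G] x in auto)

text \<open>
  The product rule determines the trilinear form \<open>T u v w = D\<^sub>u G(v, w)\<close> by the Christoffel symbols, and
  conversely \<open>G(\<Gamma> v v, w) = T v v w - T w v v / 2\<close>.  Taking \<open>w = \<Gamma> v v\<close> bounds \<open>\<Gamma> v v\<close> by the
  coefficients of \<open>T\<close>, which are continuous in the point.
\<close>

lemma christoffel_bound:
  assumes G: "metric_field S G" and K: "compact K" "K \<subseteq> S"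
  shows "\<exists>C\<ge>0. \<forall>x\<in>K. \<forall>v. norm (christoffel G x v v) \<le> C * (norm v)\<^sup>2"
proof -
  have KS: "x \<in> S" if "x \<in> K" for x using K that by blast
  obtain l where l: "0 < l" "\<And>x v. x \<in> K \<Longrightarrow> l * (norm v)\<^sup>2 \<le> G x v v"
    by (rule metric_field_bounds[OF G K]) blast
  define T where "T x u v w = frechet_derivative (\<lambda>y. G y v w) (at x) u" for x u v w
  define N where "N x = (\<Sum>i\<in>Basis. \<Sum>j\<in>Basis. \<Sum>k\<in>Basis. \<bar>T x i j k\<bar>)" for x
  have "continuous_on K N" unfolding N_def T_def
    by (intro continuous_intros continuous_on_subset[OF metric_fieldD(6)[OF G] K(2)])
  then have "bounded (N ` K)" using K(1) compact_continuous_image compact_imp_bounded by blast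
  then obtain B where B: "0 < B" "\<And>x. x \<in> K \<Longrightarrow> N x \<le> B"
    using bounded_pos[of "N ` K"] by (auto simp: real_norm_def) (meson abs_le_D1)
  have main: "norm (christoffel G x v v) \<le> (3 / 2 * B / l) * (norm v)\<^sup>2" if xK: "x \<in> K" for x v
  proof -
    let ?\<Gamma> = "christoffel G x"
    note xS = KS[OF xK]
    have bG: "bilinear (G x)" and sG: "G x v w = G x w v" for v w
      using metric_fieldD[OF G] xS by auto
    have lc: "bilinear ?\<Gamma>" "\<And>v w. ?\<Gamma> v w = ?\<Gamma> w v" "\<And>u v w. T x u v w = G x (?\<Gamma> u v) w + G x v (?\<Gamma> u w)"
      using levi_civita_christoffel[OF G xS] unfolding levi_civita_at_def T_def by blast+
    have T_exp: "T x u v w = (\<Sum>i\<in>Basis. (u \<bullet> i) * (\<Sum>j\<in>Basis. \<Sum>k\<in>Basis. (v \<bullet> j) * (w \<bullet> k) * T x i j k))"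
      for u v w
    proof -
      have bT: "bilinear (T x i)" for i
        unfolding bilinear_def lc(3)
        by (auto intro!: linearI simp: bilinear_ladd[OF bG] bilinear_radd[OF bG] bilinear_radd[OF lc(1)]
          bilinear_lmul[OF bG] bilinear_rmul[OF bG] bilinear_rmul[OF lc(1)] algebra_simps)
      have lT: "linear (\<lambda>u. T x u v w)"
        unfolding lc(3)
        by (auto intro!: linearI simp: bilinear_ladd[OF bG] bilinear_radd[OF bG] bilinear_ladd[OF lc(1)]
          bilinear_lmul[OF bG] bilinear_rmul[OF bG] bilinear_lmul[OF lc(1)] algebra_simps)
      have "T x u v w = T x (\<Sum>i\<in>Basis. (u \<bullet> i) *\<^sub>R i) v w" by (simp only: euclidean_representation)
      also have "\<dots> = (\<Sum>i\<in>Basis. (u \<bullet> i) * T x i v w)"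
        unfolding linear_sum[OF lT] linear_scale[OF lT] by simp
      finally show ?thesis by (simp add: bilinear_expand[OF bT, of _ v w])
    qed
    have T_le: "\<bar>T x u v w\<bar> \<le> norm u * norm v * norm w * B" for u v w
    proof -
      have "\<bar>T x u v w\<bar> \<le> (\<Sum>i\<in>Basis. \<bar>(u \<bullet> i) * (\<Sum>j\<in>Basis. \<Sum>k\<in>Basis. (v \<bullet> j) * (w \<bullet> k) * T x i j k)\<bar>)"
        by (subst T_exp) (rule sum_abs)
      also have "\<dots> \<le> (\<Sum>i\<in>Basis. norm u * (\<Sum>j\<in>Basis. \<Sum>k\<in>Basis. norm v * norm w * \<bar>T x i j k\<bar>))"
        unfolding abs_mult
        by (intro sum_mono mult_mono Basis_le_norm order_trans[OF sum_abs] sum_nonneg)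
          (auto simp: abs_mult intro!: mult_mono Basis_le_norm)
      also have "\<dots> = norm u * norm v * norm w * N x"
        by (simp add: N_def sum_distrib_left ac_simps)
      also have "\<dots> \<le> norm u * norm v * norm w * B"
        by (intro mult_left_mono B xK) auto
      finally show ?thesis .
    qed
    let ?w = "?\<Gamma> v v"
    have "G x ?w ?w = T x v v ?w - T x ?w v v / 2"
      unfolding lc(3) using lc(2)[of v ?w] sG[of v "?\<Gamma> v ?w"] by simp
    also have "\<dots> \<le> 3 / 2 * B * (norm v)\<^sup>2 * norm ?w"
      using T_le[of v v ?w] T_le[of ?w v v] by (simp add: power2_eq_square field_simps abs_le_iff)
    finally have "l * (norm ?w)\<^sup>2 \<le> 3 / 2 * B * (norm v)\<^sup>2 * norm ?w"
      using l(2)[OF xK, of ?w] by simp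
    then have "norm ?w * (l * norm ?w) \<le> norm ?w * (3 / 2 * B * (norm v)\<^sup>2)"
      by (simp add: power2_eq_square ac_simps)
    then have "?w = 0 \<or> l * norm ?w \<le> 3 / 2 * B * (norm v)\<^sup>2"
      by (metis mult_le_cancel_left_pos zero_less_norm_iff)
    then show ?thesis using l(1) B(1) by (auto simp: field_simps)
  qed
  show ?thesis
    by (rule exI[of _ "3 / 2 * B / l"]) (use main l(1) B(1) in auto)
qed

text \<open>
  The traced form is the Hessian of \<open>f\<close>, so that \<open>sub\<close> says that \<open>f\<close> is subharmonic.
\<close>

lemma strong_maximum_principle_metric:
  fixes f :: "'e::euclidean_space \<Rightarrow> real"
  assumes G: "metric_field S G" and p: "p \<in> S"
    and D1: "\<And>x. x \<in> S \<Longrightarrow> (f has_derivative D1 x) (at x)"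
    and D2: "\<And>x w. x \<in> S \<Longrightarrow> ((\<lambda>y. D1 y w) has_derivative (\<lambda>v. D2 x v w)) (at x)"
    and sub: "\<And>x. x \<in> S \<Longrightarrow> 0 \<le> metric_trace (G x) (\<lambda>v w. D2 x v w - D1 x (christoffel G x v w))"
    and le: "\<And>x. x \<in> S \<Longrightarrow> f x \<le> M" and fp: "f p = M"
  shows "\<exists>\<rho>>0. \<forall>x\<in>ball p \<rho>. f x = M"
proof (rule strong_maximum_principle[OF metric_fieldD(1)[OF G] p D1 D2 _ _ le fp])
  let ?E = "\<lambda>x. frame (G x)" and ?b = "\<lambda>x. \<Sum>e\<in>frame (G x). christoffel G x e e"
  show "0 \<le> (\<Sum>e\<in>?E x. D2 x e e) - D1 x (?b x)" if "x \<in> S" for x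
  proof -
    have "linear (D1 x)" using D1[OF that] has_derivative_linear by blast
    then show ?thesis using sub[OF that] by (simp add: metric_trace_frame linear_sum sum_subtractf)
  qed
  fix K assume K: "compact K" "K \<subseteq> S"
  have KS: "x \<in> S" if "x \<in> K" for x using K that by blast
  obtain l L where l: "0 < l" "0 < L" "\<And>x v. x \<in> K \<Longrightarrow> l * (norm v)\<^sup>2 \<le> G x v v"
    "\<And>x v. x \<in> K \<Longrightarrow> G x v v \<le> L * (norm v)\<^sup>2"
    by (rule metric_field_bounds[OF G K]) (rule that)
  obtain B where B: "0 \<le> B" "\<And>x v. x \<in> K \<Longrightarrow> norm (christoffel G x v v) \<le> B * (norm v)\<^sup>2"
    using christoffel_bound[OF G K] by blast
  define n where "n = real DIM('e) / l"
  have "1 / L * (norm z)\<^sup>2 \<le> (\<Sum>e\<in>?E x. (z \<bullet> e)\<^sup>2) \<and> (\<Sum>e\<in>?E x. (norm e)\<^sup>2) \<le> max n (B * n) \<and>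
      norm (?b x) \<le> max n (B * n)" if xK: "x \<in> K" for x z
  proof -
    have m: "scalar_product (G x)" using G KS[OF xK] by (simp add: metric_field_def)
    note F = frame_orthonormal[OF m]
    have "(norm z)\<^sup>2 \<le> L * (\<Sum>e\<in>?E x. (z \<bullet> e)\<^sup>2)"
      by (rule frame_elliptic[OF m]) (use l xK in auto)
    then have 1: "1 / L * (norm z)\<^sup>2 \<le> (\<Sum>e\<in>?E x. (z \<bullet> e)\<^sup>2)"
      using l(2) by (simp add: field_simps)
    have "(norm e)\<^sup>2 \<le> 1 / l" if "e \<in> ?E x" for e
      using l(3)[OF xK, of e] F(3)[OF that that] l(1) by (simp add: field_simps)
    then have 2: "(\<Sum>e\<in>?E x. (norm e)\<^sup>2) \<le> n"
      using sum_bounded_above[of "?E x" "\<lambda>e. (norm e)\<^sup>2" "1 / l"] F(2) by (simp add: n_def)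
    have "norm (?b x) \<le> (\<Sum>e\<in>?E x. B * (norm e)\<^sup>2)"
      by (rule sum_norm_le) (use B xK in auto)
    also have "\<dots> \<le> B * n" using 2 B(1) by (simp add: mult_left_mono flip: sum_distrib_left)
    finally show ?thesis using 1 2 by auto
  qed
  then show "\<exists>c C. 0 < c \<and> (\<forall>x\<in>K. (\<forall>z. c * (norm z)\<^sup>2 \<le> (\<Sum>e\<in>?E x. (z \<bullet> e)\<^sup>2)) \<and>
               (\<Sum>e\<in>?E x. (norm e)\<^sup>2) \<le> C \<and> norm (?b x) \<le> C)"
    using l(2) by (intro exI[of _ "1 / L"] exI[of _ "max n (B * n)"]) auto
qed

section \<open>Compactness of closed balls in complete length spaces\<close>

text \<open>
  Cohn-Vossen's argument.  Let \<open>R\<close> be the supremum of the radii \<open>t\<close> for which the closed ball of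
  radius \<open>t\<close> around \<open>p\<close> is compact, supposed to be finite.  Every point of the ball of radius \<open>R\<close> is close to a
  ball of slightly smaller radius, so it is totally bounded, and by completeness compact.  A finite
  cover by compact balls then covers a slightly larger ball as well, contradicting the choice of \<open>R\<close>.
\<close>

theorem (in Metric_space) proper_if_complete_locally_compact_length:
  assumes complete: mcomplete
    and loc: "\<And>x. x \<in> M \<Longrightarrow> \<exists>e>0. compactin mtopology (mcball x e)"
    and split: "\<And>x y r s. \<lbrakk>x \<in> M; y \<in> M; 0 < r; 0 < s; d x y < r + s\<rbrakk>
                  \<Longrightarrow> \<exists>z\<in>M. d x z \<le> r \<and> d z y < s"
    and p: "p \<in> M"
  shows "compactin mtopology (mcball p r)"
proof (rule ccontr)
  assume not: "\<not> compactin mtopology (mcball p r)"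
  have down: "compactin mtopology (mcball p r1)" if "compactin mtopology (mcball p r2)" "r1 \<le> r2" for r1 r2
    by (rule closed_compactin[OF that(1)]) (use that in \<open>auto simp: mcball_subset_concentric\<close>)
  define S where "S = {t. 0 < t \<and> compactin mtopology (mcball p t)}"
  obtain e0 where e0: "e0 \<in> S" using loc[OF p] by (auto simp: S_def)
  have bd: "t \<le> r" if "t \<in> S" for t
    using not down[of t r] that unfolding S_def by force
  then have bdd: "bdd_above S" by (meson bdd_aboveI)
  define R where "R = Sup S"
  have R0: "0 < R" using cSup_upper[OF e0 bdd] e0 unfolding S_def R_def by auto
  have below: "compactin mtopology (mcball p t)" if tR: "t < R" for t
  proof -
    have "S \<noteq> {}" using e0 by auto
    then obtain t' where "t' \<in> S" "t < t'"
      using less_cSup_iff[of S t] tR bdd unfolding R_def by blast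
    then show ?thesis using down[of t' t] unfolding S_def by auto
  qed
  have "mtotally_bounded (mcball p R)"
    unfolding mtotally_bounded_def
  proof (intro allI impI)
    fix e :: real assume e: "0 < e"
    define t where "t = max (R/2) (R - e/4)"
    have t: "0 < t" "t < R" "R < t + e/2" unfolding t_def using R0 e by auto
    have "mtotally_bounded (mcball p t)"
      using below[OF t(2)] compactin_imp_mtotally_bounded by blast
    then obtain K where K: "finite K" "K \<subseteq> mcball p t" "mcball p t \<subseteq> (\<Union>x\<in>K. mball x (e/2))"
      unfolding mtotally_bounded_def using half_gt_zero[OF e] by metis
    have "mcball p R \<subseteq> (\<Union>x\<in>K. mball x e)"
    proof
      fix y assume y: "y \<in> mcball p R"
      then have yM: "y \<in> M" and "d p y < t + e/2" using t by auto
      with split[OF p yM t(1), of "e/2"] e obtain z where z: "z \<in> M" "d p z \<le> t" "d z y < e/2" by auto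
      then have "z \<in> mcball p t" using p by auto
      then obtain x where x: "x \<in> K" "z \<in> mball x (e/2)" using K by blast
      then have "d x y < e" using triangle[of x z y] z yM by auto
      then show "y \<in> (\<Union>x\<in>K. mball x e)" using x yM by auto
    qed
    moreover have "mcball p t \<subseteq> mcball p R" using t by (simp add: mcball_subset_concentric)
    ultimately show "\<exists>K. finite K \<and> K \<subseteq> mcball p R \<and> mcball p R \<subseteq> (\<Union>x\<in>K. mball x e)"
      using K by blast
  qed
  then have "compactin mtopology (mtopology closure_of mcball p R)"
    using mtotally_bounded_eq_compact_closure_of[OF complete] by blast
  then have cR: "compactin mtopology (mcball p R)"
    by (simp add: closure_of_closedin)
  from loc obtain e where e: "\<And>x. x \<in> M \<Longrightarrow> 0 < e x \<and> compactin mtopology (mcball x (e x))" by metis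
  have "\<exists>\<F>. finite \<F> \<and> \<F> \<subseteq> (\<lambda>x. mball x (e x / 2)) ` mcball p R \<and> mcball p R \<subseteq> \<Union>\<F>"
    using cR unfolding compactin_def
    by (elim conjE allE[of _ "(\<lambda>x. mball x (e x / 2)) ` mcball p R"]) (use e in force)
  then obtain F where F: "finite F" "F \<subseteq> mcball p R" "mcball p R \<subseteq> (\<Union>x\<in>F. mball x (e x / 2))"
    by (metis (no_types, lifting) finite_subset_image)
  have Fne: "F \<noteq> {}" using F p R0 centre_in_mcball_iff by fastforce
  define \<delta> where "\<delta> = Min ((\<lambda>x. e x / 2) ` F)"
  have \<delta>: "0 < \<delta>" "\<And>x. x \<in> F \<Longrightarrow> \<delta> \<le> e x / 2"
  proof -
    show "0 < \<delta>" unfolding \<delta>_def using F Fne e by (subst Min_gr_iff) (auto simp: subset_iff)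
    show "\<delta> \<le> e x / 2" if "x \<in> F" for x unfolding \<delta>_def using F(1) that by (intro Min_le) auto
  qed
  have "mcball p (R + \<delta>/2) \<subseteq> (\<Union>x\<in>F. mcball x (e x))"
  proof
    fix y assume y: "y \<in> mcball p (R + \<delta>/2)"
    then have yM: "y \<in> M" and "d p y < R + \<delta>" using \<delta> by auto
    with split[OF p yM R0 \<delta>(1)] obtain z where z: "z \<in> M" "d p z \<le> R" "d z y < \<delta>" by auto
    then have "z \<in> mcball p R" using p by auto
    then obtain x where x: "x \<in> F" "z \<in> mball x (e x/2)" using F by blast
    then have "d x y \<le> e x" using triangle[of x z y] z yM \<delta>(2)[OF x(1)] by auto
    then show "y \<in> (\<Union>x\<in>F. mcball x (e x))" using x yM by auto
  qed
  moreover have "compactin mtopology (\<Union>x\<in>F. mcball x (e x))"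
    using F e by (intro compactin_Union) auto
  ultimately have "compactin mtopology (mcball p (R + \<delta>/2))"
    using closed_compactin closedin_mcball by blast
  then have "R + \<delta>/2 \<in> S" using R0 \<delta> by (auto simp: S_def)
  then have "R + \<delta>/2 \<le> R" unfolding R_def using cSup_upper bdd by blast
  then show False using \<delta> by simp
qed

section \<open>Lengths of curves in a Riemannian manifold\<close>

locale riemannian_manifold =
  fixes A :: "('a::{t2_space, second_countable_topology}, 'e::euclidean_space) chart set"
    and g :: "('a, 'e) metric_tensor"
  assumes atlas: "smooth_atlas A" and metric: "riemannian_metric A g"
begin

abbreviation param :: "('a, 'e) chart \<Rightarrow> 'e \<Rightarrow> 'a" where
  "param c \<equiv> inv_into (fst c) (snd c)"

lemma chart:
  assumes "c \<in> A"
  shows "open (fst c)" "open (snd c ` fst c)" "continuous_on (fst c) (snd c)"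
    "continuous_on (snd c ` fst c) (param c)"
    "p \<in> fst c \<Longrightarrow> param c (snd c p) = p" "x \<in> snd c ` fst c \<Longrightarrow> snd c (param c x) = x"
    "x \<in> snd c ` fst c \<Longrightarrow> param c x \<in> fst c"
proof -
  have "is_chart c" using assms atlas by (simp add: smooth_atlas_def)
  then have h: "open (fst c)" "open (snd c ` fst c)"
    and hom: "homeomorphism (fst c) (snd c ` fst c) (snd c) (param c)"
    by (auto simp: is_chart_def)
  from h hom show "open (fst c)" "open (snd c ` fst c)" "continuous_on (fst c) (snd c)"
    "continuous_on (snd c ` fst c) (param c)"
    "p \<in> fst c \<Longrightarrow> param c (snd c p) = p"
    by (simp_all add: homeomorphism_def)
  show "x \<in> snd c ` fst c \<Longrightarrow> snd c (param c x) = x" by (rule f_inv_into_f)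
  show "x \<in> snd c ` fst c \<Longrightarrow> param c x \<in> fst c" by (rule inv_into_into)
qed

lemma chart_at: obtains c where "c \<in> A" "p \<in> fst c"
proof -
  have "p \<in> (\<Union>c\<in>A. fst c)" using atlas by (simp add: smooth_atlas_def)
  then show ?thesis using that by blast
qed

lemma open_chart_image:
  assumes "c \<in> A" "open V"
  shows "open (snd c ` (fst c \<inter> V))"
proof -
  have "open (snd c ` fst c \<inter> param c -` V)"
    by (rule continuous_open_preimage[OF chart(4,2)[OF assms(1)] assms(2)])
  moreover have "snd c ` fst c \<inter> param c -` V = snd c ` (fst c \<inter> V)"
    using chart(5)[OF assms(1)] by force
  ultimately show ?thesis by simp
qed

lemma metric_field_chart: "c \<in> A \<Longrightarrow> metric_field (snd c ` fst c) (g c)"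
  using metric chart(2) unfolding riemannian_metric_def metric_field_def scalar_product_def smooth_on_def by blast

lemma transition:
  assumes "c \<in> A" "d \<in> A"
  shows "x \<in> snd c ` (fst c \<inter> fst d) \<Longrightarrow>
      (local_rep c d id has_derivative frechet_derivative (local_rep c d id) (at x)) (at x)"
    and "continuous_on (snd c ` (fst c \<inter> fst d)) (\<lambda>x. frechet_derivative (local_rep c d id) (at x) v)"
proof -
  have "Ck_on 1 (snd c ` (fst c \<inter> fst d)) (local_rep c d id)"
    using assms atlas unfolding smooth_atlas_def smooth_compatible_def smooth_on_def by blast
  then show "x \<in> snd c ` (fst c \<inter> fst d) \<Longrightarrow>
      (local_rep c d id has_derivative frechet_derivative (local_rep c d id) (at x)) (at x)"
    and "continuous_on (snd c ` (fst c \<inter> fst d)) (\<lambda>x. frechet_derivative (local_rep c d id) (at x) v)"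
    by (auto simp: frechet_derivative_works)
qed

text \<open>
  Tangent vectors of curves transform by the derivative of the transition map.  The filter covers
  one-sided derivatives at the ends of an interval.
\<close>

lemma chart_change_derivative:
  assumes c: "c \<in> A" "\<gamma> t \<in> fst c" and d: "d \<in> A" "\<gamma> t \<in> fst d"
    and I: "t \<in> I" and cont: "(\<gamma> \<longlongrightarrow> \<gamma> t) (at t within I)"
    and der: "((snd c \<circ> \<gamma>) has_vector_derivative v) (at t within I)"
  shows "((snd d \<circ> \<gamma>) has_vector_derivative
      frechet_derivative (local_rep c d id) (at (snd c (\<gamma> t))) v) (at t within I)"
proof -
  let ?T = "local_rep c d id"
  let ?DT = "frechet_derivative ?T (at (snd c (\<gamma> t)))"
  have x: "snd c (\<gamma> t) \<in> snd c ` (fst c \<inter> fst d)" using c d by auto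
  note T = transition(1)[OF c(1) d(1) x]
  have "((\<lambda>s. ?T ((snd c \<circ> \<gamma>) s)) has_derivative (\<lambda>s. ?DT (s *\<^sub>R v))) (at t within I)"
    by (rule has_derivative_compose[OF der[unfolded has_vector_derivative_def], where g = ?T])
      (unfold o_apply, rule T)
  moreover have "(\<lambda>s. ?DT (s *\<^sub>R v)) = (\<lambda>s. s *\<^sub>R ?DT v)"
    using linear_scale[OF has_derivative_linear[OF T]] by (simp add: fun_eq_iff)
  moreover have "\<forall>\<^sub>F s in at t within I. ?T ((snd c \<circ> \<gamma>) s) = (snd d \<circ> \<gamma>) s"
  proof (rule eventually_mono)
    show "\<forall>\<^sub>F s in at t within I. \<gamma> s \<in> fst c"
      by (rule topological_tendstoD[OF cont chart(1)[OF c(1)] c(2)])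
    show "?T ((snd c \<circ> \<gamma>) s) = (snd d \<circ> \<gamma>) s" if "\<gamma> s \<in> fst c" for s
      using chart(5)[OF c(1) that] by (simp add: local_rep_def)
  qed
  ultimately show ?thesis
    unfolding has_vector_derivative_def
    using has_derivative_transform_eventually[of "\<lambda>s. ?T ((snd c \<circ> \<gamma>) s)" _ t I "snd d \<circ> \<gamma>"] I
      chart(5)[OF c] by (simp add: local_rep_def)
qed

lemma metric_invariant:
  assumes c: "c \<in> A" "p \<in> fst c" and d: "d \<in> A" "p \<in> fst d"
  shows "g d (snd d p) (frechet_derivative (local_rep c d id) (at (snd c p)) v)
        (frechet_derivative (local_rep c d id) (at (snd c p)) w) = g c (snd c p) v w"
  using metric c d unfolding riemannian_metric_def Let_def by (metis IntI)

lemma metric_nonneg: "c \<in> A \<Longrightarrow> p \<in> fst c \<Longrightarrow> 0 \<le> g c (snd c p) v v"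
  using metric_fieldD(2,4)[OF metric_field_chart[of c], of "snd c p"]
  by (cases "v = 0") (auto simp: bilinear_lzero intro: less_imp_le)

lemma chosen_chart:
  "(SOME c. c \<in> A \<and> p \<in> fst c) \<in> A" "p \<in> fst (SOME c. c \<in> A \<and> p \<in> fst c)"
proof -
  obtain c where "c \<in> A \<and> p \<in> fst c" using chart_at by blast
  from someI[of "\<lambda>c. c \<in> A \<and> p \<in> fst c", OF this]
  show "(SOME c. c \<in> A \<and> p \<in> fst c) \<in> A" "p \<in> fst (SOME c. c \<in> A \<and> p \<in> fst c)" by blast+
qed

lemma speed_nonneg: "0 \<le> speed A g \<gamma> t"
  unfolding speed_def Let_def using metric_nonneg chosen_chart by simp

lemma speed_eq:
  assumes c: "c \<in> A" "\<gamma> t \<in> fst c" and cont: "isCont \<gamma> t"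
    and der: "((snd c \<circ> \<gamma>) has_vector_derivative v) (at t)"
  shows "speed A g \<gamma> t = sqrt (g c (snd c (\<gamma> t)) v v)"
proof -
  define d where "d = (SOME c. c \<in> A \<and> \<gamma> t \<in> fst c)"
  have d: "d \<in> A" "\<gamma> t \<in> fst d" unfolding d_def by (rule chosen_chart)+
  have "((snd d \<circ> \<gamma>) has_vector_derivative
      frechet_derivative (local_rep c d id) (at (snd c (\<gamma> t))) v) (at t)"
    by (rule chart_change_derivative[where I = UNIV and \<gamma> = \<gamma> and t = t, OF c d])
      (use cont der in \<open>simp_all add: isCont_def\<close>)
  from vector_derivative_at[OF this] show ?thesis
    unfolding speed_def Let_def d_def[symmetric] by (simp add: metric_invariant[OF c d])
qed

definition velocity :: "('a, 'e) chart \<Rightarrow> (real \<Rightarrow> 'a) \<Rightarrow> real \<Rightarrow> 'e" where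
  "velocity c \<gamma> t = vector_derivative (snd c \<circ> \<gamma>) (at t)"

lemma C1_interior:
  assumes \<gamma>: "C1_curve A a b \<gamma>" and t: "t \<in> {a<..<b}" and c: "c \<in> A" "\<gamma> t \<in> fst c"
  shows "isCont \<gamma> t" "((snd c \<circ> \<gamma>) has_vector_derivative velocity c \<gamma> t) (at t)"
    "speed A g \<gamma> t = sqrt (g c (snd c (\<gamma> t)) (velocity c \<gamma> t) (velocity c \<gamma> t))"
proof -
  have at: "at t within {a..b} = at t" using t by (simp add: at_within_Icc_at)
  show cont: "isCont \<gamma> t"
    using \<gamma> t unfolding C1_curve_def continuous_on_eq_continuous_within by (auto simp flip: at)
  have "t \<in> {a..b} \<inter> \<gamma> -` fst c" using t c by auto
  then obtain D where "((snd c \<circ> \<gamma>) has_vector_derivative D t) (at t within {a..b})"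
    using \<gamma> c(1) unfolding C1_curve_def by blast
  then show der: "((snd c \<circ> \<gamma>) has_vector_derivative velocity c \<gamma> t) (at t)"
    unfolding at velocity_def by (metis vector_derivative_at)
  show "speed A g \<gamma> t = sqrt (g c (snd c (\<gamma> t)) (velocity c \<gamma> t) (velocity c \<gamma> t))"
    by (rule speed_eq[OF c cont der])
qed

text \<open>
  The speed formed with one-sided derivatives at the endpoints is continuous on the closed interval,
  as can be seen in a single chart around each point, and it differs from the speed at the
  endpoints only.
\<close>

lemma C1_speed_integrable:
  assumes ab: "a < b" and \<gamma>: "C1_curve A a b \<gamma>"
  shows "speed A g \<gamma> integrable_on {a..b}"
proof -
  let ?I = "{a..b}"
  have cont: "continuous_on ?I \<gamma>" using \<gamma> by (simp add: C1_curve_def)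
  define ch where "ch t = (SOME c. c \<in> A \<and> \<gamma> t \<in> fst c)" for t
  define V where "V c t = vector_derivative (snd c \<circ> \<gamma>) (at t within ?I)" for c :: "('a, 'e) chart" and t
  define \<sigma> where "\<sigma> t = sqrt (g (ch t) (snd (ch t) (\<gamma> t)) (V (ch t) t) (V (ch t) t))" for t
  have der: "((snd c \<circ> \<gamma>) has_vector_derivative V c t) (at t within ?I)"
    if c: "c \<in> A" and t: "t \<in> ?I" "\<gamma> t \<in> fst c" for c t
  proof -
    have "t \<in> ?I \<inter> \<gamma> -` fst c" using t by auto
    then obtain D where D: "((snd c \<circ> \<gamma>) has_vector_derivative D t) (at t within ?I)"
      using \<gamma> c unfolding C1_curve_def by blast
    then show ?thesis unfolding V_def
      by (simp add: vector_derivative_within_closed_interval[OF ab t(1) D])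
  qed
  have \<sigma>: "\<sigma> t = sqrt (g c (snd c (\<gamma> t)) (V c t) (V c t))" if "c \<in> A" "t \<in> ?I" "\<gamma> t \<in> fst c" for c t
  proof -
    have d: "ch t \<in> A" "\<gamma> t \<in> fst (ch t)" unfolding ch_def by (rule chosen_chart)+
    have "((snd (ch t) \<circ> \<gamma>) has_vector_derivative
      frechet_derivative (local_rep c (ch t) id) (at (snd c (\<gamma> t))) (V c t)) (at t within ?I)"
      by (rule chart_change_derivative[OF that(1,3) d that(2) _ der[OF that]])
        (use cont that(2) in \<open>simp add: continuous_on_def\<close>)
    from vector_derivative_within_closed_interval[OF ab that(2) this]
    have "V (ch t) t = frechet_derivative (local_rep c (ch t) id) (at (snd c (\<gamma> t))) (V c t)"
      by (simp add: V_def)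
    then show ?thesis unfolding \<sigma>_def by (simp add: metric_invariant[OF that(1,3) d])
  qed
  have "continuous_on ?I \<sigma>"
    unfolding continuous_on_eq_continuous_within
  proof
    fix t assume t: "t \<in> ?I"
    obtain c where c: "c \<in> A" "\<gamma> t \<in> fst c" using chart_at by blast
    let ?J = "?I \<inter> \<gamma> -` fst c"
    obtain D where D: "continuous_on ?J D"
      "\<And>s. s \<in> ?J \<Longrightarrow> ((snd c \<circ> \<gamma>) has_vector_derivative D s) (at s within ?I)"
      using \<gamma> c(1) unfolding C1_curve_def by blast
    have DV: "D s = V c s" if "s \<in> ?J" for s
      unfolding V_def using vector_derivative_within_closed_interval[OF ab _ D(2)[OF that]] that by simp
    note G = metric_field_chart[OF c(1)]
    have "continuous_on ?J (\<lambda>s. sqrt (g c (snd c (\<gamma> s)) (D s) (D s)))"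
      by (intro continuous_on_real_sqrt continuous_on_metric[OF metric_fieldD(2,7)[OF G]] D(1)
          continuous_on_compose2[OF chart(3)[OF c(1)] continuous_on_subset[OF cont]]) auto
    then have "continuous_on ?J \<sigma>"
      by (rule continuous_on_eq) (use \<sigma> c DV in auto)
    then have cJ: "continuous (at t within ?J) \<sigma>"
      using t c continuous_on_eq_continuous_within by blast
    have "openin (top_of_set ?I) ?J"
      by (rule continuous_openin_preimage_gen[OF cont chart(1)[OF c(1)]])
    then obtain W where W: "open W" "?J = ?I \<inter> W" by (auto simp: openin_open)
    have "t \<in> ?J" using t c by simp
    then have "t \<in> W" unfolding W(2) by blast
    then have "at t within ?J = at t within ?I"
      unfolding W(2) by (intro at_within_nhd[of t W] W(1)) auto
    with cJ show "continuous (at t within ?I) \<sigma>" by simp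
  qed
  then have int: "\<sigma> integrable_on ?I" by (rule integrable_continuous_interval)
  have eq: "speed A g \<gamma> t = \<sigma> t" if "t \<in> ?I - {a, b}" for t
  proof -
    have ti: "t \<in> {a<..<b}" using that by auto
    obtain c where c: "c \<in> A" "\<gamma> t \<in> fst c" using chart_at by blast
    have "V c t = velocity c \<gamma> t" using ti by (simp add: V_def velocity_def at_within_Icc_at)
    then show ?thesis using C1_interior(3)[OF \<gamma> ti c] \<sigma>[OF c(1) _ c(2)] that by simp
  qed
  show ?thesis by (rule integrable_spike_finite[where S = "{a, b}", OF _ eq int]) simp_all
qed

definition len :: "(real \<Rightarrow> 'a) \<Rightarrow> real \<Rightarrow> real \<Rightarrow> real" where
  "len \<gamma> a b = integral {a..b} (speed A g \<gamma>)"

text \<open>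
  The comparison is assumed on the open interval because the speed is a two-sided derivative, which
  is meaningless at the ends of the curve.
\<close>

lemma len_le:
  assumes "speed A g \<gamma> integrable_on {a..b}" "B integrable_on {a..b}"
    and "\<And>t. t \<in> {a<..<b} \<Longrightarrow> speed A g \<gamma> t \<le> B t"
  shows "len \<gamma> a b \<le> integral {a..b} B"
proof -
  let ?s = "\<lambda>t. if t \<in> {a<..<b} then speed A g \<gamma> t else B t"
  have "(?s has_integral len \<gamma> a b) {a..b}"
    by (rule has_integral_spike_finite[of "{a,b}" _ _ "speed A g \<gamma>"])
      (use assms(1) in \<open>auto simp: len_def\<close>)
  then show ?thesis
    by (rule has_integral_le[OF _ integrable_integral[OF assms(2)]]) (use assms(3) in auto)
qed

text \<open>
  Piecewise \<open>C\<^sup>1\<close> curves on an arbitrary interval, built by appending pieces.  This form, unlike a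
  partition of \<open>[0, 1]\<close>, lets facts about \<open>C\<^sup>1\<close> pieces be lifted by induction.
\<close>

inductive pw_C1 :: "(real \<Rightarrow> 'a) \<Rightarrow> real \<Rightarrow> real \<Rightarrow> bool" for \<gamma> where
  single: "a < b \<Longrightarrow> C1_curve A a b \<gamma> \<Longrightarrow> pw_C1 \<gamma> a b"
| snoc: "pw_C1 \<gamma> a b \<Longrightarrow> b < c \<Longrightarrow> C1_curve A b c \<gamma> \<Longrightarrow> pw_C1 \<gamma> a c"

lemma pw_C1_less: "pw_C1 \<gamma> a b \<Longrightarrow> a < b"
  by (induction rule: pw_C1.induct) auto

lemma pw_C1_trans: "pw_C1 \<gamma> b c \<Longrightarrow> pw_C1 \<gamma> a b \<Longrightarrow> pw_C1 \<gamma> a c"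
proof (induction rule: pw_C1.induct)
  case (single b c) then show ?case using snoc by blast
next
  case (snoc b c d) then show ?case using pw_C1.snoc[of \<gamma> a c d] by blast
qed

lemma pw_C1_integrable: "pw_C1 \<gamma> a b \<Longrightarrow> speed A g \<gamma> integrable_on {a..b}"
proof (induction rule: pw_C1.induct)
  case (snoc a b c)
  show ?case
    by (rule Henstock_Kurzweil_Integration.integrable_combine[OF _ _ snoc.IH C1_speed_integrable[OF snoc.hyps(2,3)]])
      (use pw_C1_less[OF snoc.hyps(1)] snoc.hyps(2) in simp_all)
qed (rule C1_speed_integrable)

lemma len_combine:
  assumes "speed A g \<gamma> integrable_on {a..c}" "a \<le> b" "b \<le> c"
  shows "len \<gamma> a c = len \<gamma> a b + len \<gamma> b c"
  unfolding len_def using Henstock_Kurzweil_Integration.integral_combine[OF assms(2,3,1)] by simp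

lemma pw_C1_snoc_len:
  assumes "pw_C1 \<gamma> a b" "b < c" "C1_curve A b c \<gamma>"
  shows "len \<gamma> a c = len \<gamma> a b + len \<gamma> b c"
  by (rule len_combine[OF pw_C1_integrable[OF snoc[OF assms]]])
    (use pw_C1_less[OF assms(1)] assms(2) in simp_all)

lemma piecewise_C1_curve_iff: "piecewise_C1_curve A \<gamma> \<longleftrightarrow> pw_C1 \<gamma> 0 1"
proof
  assume "piecewise_C1_curve A \<gamma>"
  then obtain N :: nat and t where t: "t 0 = (0::real)" "t N = 1"
    "\<And>i. i < N \<Longrightarrow> t i < t (Suc i) \<and> C1_curve A (t i) (t (Suc i)) \<gamma>"
    unfolding piecewise_C1_curve_def by blast
  have "pw_C1 \<gamma> (t 0) (t (Suc i))" if "i < N" for i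
    using that
  proof (induction i)
    case 0 then show ?case using t(3)[of 0] single by blast
  next
    case (Suc i)
    then have "pw_C1 \<gamma> (t 0) (t (Suc i))" by simp
    with Suc.prems show ?case using t(3)[of "Suc i"] snoc by blast
  qed
  from this[of "N - 1"] t show "pw_C1 \<gamma> 0 1" by (cases N) auto
next
  have "\<exists>(N::nat) t. t 0 = a \<and> t N = b \<and> (\<forall>i<N. t i < t (Suc i) \<and> C1_curve A (t i) (t (Suc i)) \<gamma>)"
    if "pw_C1 \<gamma> a b" for a b
    using that
  proof (induction rule: pw_C1.induct)
    case (single a b)
    then show ?case by (intro exI[of _ 1] exI[of _ "\<lambda>i. if i = 0 then a else b"]) auto
  next
    case (snoc a b c)
    then obtain N :: nat and t where "t 0 = a" "t N = b"
      "\<forall>i<N. t i < t (Suc i) \<and> C1_curve A (t i) (t (Suc i)) \<gamma>" by blast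
    then show ?case using snoc.hyps
      by (intro exI[of _ "Suc N"] exI[of _ "\<lambda>i. if i \<le> N then t i else c"]) (auto simp: less_Suc_eq)
  qed
  then show "pw_C1 \<gamma> 0 1 \<Longrightarrow> piecewise_C1_curve A \<gamma>" unfolding piecewise_C1_curve_def by blast
qed

lemma C1_cong:
  assumes \<gamma>: "C1_curve A a b \<gamma>" and eq: "\<And>t. t \<in> {a..b} \<Longrightarrow> \<gamma> t = \<delta> t"
  shows "C1_curve A a b \<delta>" "len \<delta> a b = len \<gamma> a b"
proof -
  show \<delta>: "C1_curve A a b \<delta>"
    unfolding C1_curve_def
  proof (intro conjI ballI)
    show "continuous_on {a..b} \<delta>"
      by (rule continuous_on_eq[of _ \<gamma>]) (use \<gamma> eq in \<open>auto simp: C1_curve_def\<close>)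
    fix c assume c: "c \<in> A"
    have J: "{a..b} \<inter> \<delta> -` fst c = {a..b} \<inter> \<gamma> -` fst c" using eq by auto
    obtain D where D: "continuous_on ({a..b} \<inter> \<gamma> -` fst c) D"
      "\<And>t. t \<in> {a..b} \<inter> \<gamma> -` fst c \<Longrightarrow> ((snd c \<circ> \<gamma>) has_vector_derivative D t) (at t within {a..b})"
      using \<gamma> c unfolding C1_curve_def by blast
    have "((snd c \<circ> \<delta>) has_vector_derivative D t) (at t within {a..b})"
      if "t \<in> {a..b} \<inter> \<gamma> -` fst c" for t
      by (rule has_vector_derivative_transform[OF _ _ D(2)[OF that]]) (use that eq in auto)
    then show "\<exists>D. continuous_on ({a..b} \<inter> \<delta> -` fst c) D \<and>
        (\<forall>t\<in>{a..b} \<inter> \<delta> -` fst c. ((snd c \<circ> \<delta>) has_vector_derivative D t) (at t within {a..b}))"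
      unfolding J using D(1) by blast
  qed
  have sp: "speed A g \<delta> t = speed A g \<gamma> t" if t: "t \<in> {a<..<b}" for t
  proof -
    obtain c where c: "c \<in> A" "\<gamma> t \<in> fst c" using chart_at by blast
    have et: "\<delta> t = \<gamma> t" using eq t by simp
    have "((snd c \<circ> \<delta>) has_vector_derivative velocity c \<gamma> t) (at t)"
      by (rule has_vector_derivative_transform_within_open[OF C1_interior(2)[OF \<gamma> t c], of "{a<..<b}"])
        (use t eq in auto)
    then have "speed A g \<delta> t = sqrt (g c (snd c (\<delta> t)) (velocity c \<gamma> t) (velocity c \<gamma> t))"
      using c et by (intro speed_eq C1_interior(1)[OF \<delta> t]) auto
    then show ?thesis using C1_interior(3)[OF \<gamma> t c] et by simp
  qed
  show "len \<delta> a b = len \<gamma> a b" unfolding len_def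
    by (rule integral_spike[of "{a,b}"]) (simp add: negligible_finite, rule sp[symmetric], auto)
qed

lemma pw_C1_cong:
  "pw_C1 \<gamma> a b \<Longrightarrow> (\<And>t. t \<in> {a..b} \<Longrightarrow> \<gamma> t = \<delta> t) \<Longrightarrow> pw_C1 \<delta> a b \<and> len \<delta> a b = len \<gamma> a b"
proof (induction rule: pw_C1.induct)
  case (single a b) then show ?case using C1_cong[of a b \<gamma> \<delta>] by (auto intro: pw_C1.single)
next
  case (snoc a b c)
  note lt = pw_C1_less[OF snoc.hyps(1)]
  have 1: "pw_C1 \<delta> a b" "len \<delta> a b = len \<gamma> a b" using snoc lt by auto
  have 2: "C1_curve A b c \<delta>" "len \<delta> b c = len \<gamma> b c"
    using C1_cong[OF snoc.hyps(3), of \<delta>] snoc.prems lt by auto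
  show ?case
    using pw_C1_snoc_len[OF snoc.hyps] pw_C1_snoc_len[OF 1(1) snoc.hyps(2) 2(1)] 1 2
      pw_C1.snoc[OF 1(1) snoc.hyps(2) 2(1)] by simp
qed

text \<open>
  Negative \<open>m\<close> is included, for the reversal of curves.
\<close>

lemma C1_affine:
  assumes \<gamma>: "C1_curve A a b \<gamma>" and m: "m \<noteq> 0" and im: "(\<lambda>s. m * s + k) ` {a'..b'} = {a..b}"
    and lt: "a < b" "a' < b'"
  shows "C1_curve A a' b' (\<lambda>s. \<gamma> (m * s + k))" "len (\<lambda>s. \<gamma> (m * s + k)) a' b' = len \<gamma> a b"
proof -
  let ?\<phi> = "\<lambda>s. m * s + k" and ?\<delta> = "\<lambda>s. \<gamma> (m * s + k)"
  have mem: "?\<phi> s \<in> {a..b}" if "s \<in> {a'..b'}" for s using im that by blast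
  show \<delta>: "C1_curve A a' b' ?\<delta>"
    unfolding C1_curve_def
  proof (intro conjI ballI)
    show "continuous_on {a'..b'} ?\<delta>"
      by (rule continuous_on_compose2[of "{a..b}" \<gamma>])
        (use \<gamma> mem in \<open>auto simp: C1_curve_def intro!: continuous_intros\<close>)
    fix c assume c: "c \<in> A"
    let ?J = "{a..b} \<inter> \<gamma> -` fst c" and ?J' = "{a'..b'} \<inter> ?\<delta> -` fst c"
    obtain D where D: "continuous_on ?J D"
      "\<And>t. t \<in> ?J \<Longrightarrow> ((snd c \<circ> \<gamma>) has_vector_derivative D t) (at t within {a..b})"
      using \<gamma> c unfolding C1_curve_def by blast
    show "\<exists>D. continuous_on ?J' D \<and>
        (\<forall>t\<in>?J'. ((snd c \<circ> ?\<delta>) has_vector_derivative D t) (at t within {a'..b'}))"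
    proof (intro exI conjI ballI)
      show "continuous_on ?J' (\<lambda>s. m *\<^sub>R D (?\<phi> s))"
        by (intro continuous_intros continuous_on_compose2[OF D(1)]) (use mem in auto)
      fix s assume s: "s \<in> ?J'"
      have "(?\<phi> has_vector_derivative m) (at s within {a'..b'})"
        by (auto intro!: derivative_eq_intros)
      moreover have "((snd c \<circ> \<gamma>) has_vector_derivative D (?\<phi> s)) (at (?\<phi> s) within ?\<phi> ` {a'..b'})"
        unfolding im using D(2) s mem by auto
      ultimately show "((snd c \<circ> ?\<delta>) has_vector_derivative m *\<^sub>R D (?\<phi> s)) (at s within {a'..b'})"
        using vector_diff_chain_within by (fastforce simp: o_def)
    qed
  qed
  have int: "?\<phi> s \<in> {a<..<b}" if s: "s \<in> {a'<..<b'}" for s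
  proof -
    have "?\<phi> ` {a'..b'} = (if 0 \<le> m then {m * a' + k..m * b' + k} else {m * b' + k..m * a' + k})"
      using lt by (simp add: image_affinity_atLeastAtMost)
    then have "{a..b} = (if 0 \<le> m then {m * a' + k..m * b' + k} else {m * b' + k..m * a' + k})"
      using im by simp
    then show ?thesis using s m lt by (auto split: if_splits simp: Icc_eq_Icc mult_le_cancel_left)
  qed
  have sp: "speed A g ?\<delta> s = \<bar>m\<bar> * speed A g \<gamma> (?\<phi> s)" if s: "s \<in> {a'<..<b'}" for s
  proof -
    obtain c where c: "c \<in> A" "\<gamma> (?\<phi> s) \<in> fst c" using chart_at by blast
    let ?v = "velocity c \<gamma> (?\<phi> s)"
    have "(?\<phi> has_vector_derivative m) (at s)" by (auto intro!: derivative_eq_intros)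
    from vector_diff_chain_at[OF this C1_interior(2)[OF \<gamma> int[OF s] c]]
    have "((snd c \<circ> ?\<delta>) has_vector_derivative m *\<^sub>R ?v) (at s)" by (simp add: o_def)
    then have "speed A g ?\<delta> s = sqrt (g c (snd c (?\<delta> s)) (m *\<^sub>R ?v) (m *\<^sub>R ?v))"
      using c by (intro speed_eq C1_interior(1)[OF \<delta> s]) auto
    also have "\<dots> = sqrt (m\<^sup>2 * g c (snd c (?\<delta> s)) ?v ?v)"
    proof -
      have "bilinear (g c (snd c (?\<delta> s)))"
        by (rule metric_fieldD(2)[OF metric_field_chart[OF c(1)]]) (use c in auto)
      then show ?thesis by (simp add: bilinear_lmul bilinear_rmul power2_eq_square)
    qed
    also have "\<dots> = \<bar>m\<bar> * speed A g \<gamma> (?\<phi> s)"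
      using C1_interior(3)[OF \<gamma> int[OF s] c] by (simp add: real_sqrt_mult)
    finally show ?thesis .
  qed
  have inv_im: "(\<lambda>x. (1 / m) *\<^sub>R x + - ((1 / m) *\<^sub>R k)) ` {a..b} = {a'..b'}"
    unfolding im[symmetric] image_image using m by (simp add: field_simps)
  have "(speed A g \<gamma> has_integral len \<gamma> a b) (cbox a b)"
    unfolding len_def using integrable_integral[OF C1_speed_integrable[OF lt(1) \<gamma>]] by simp
  from has_integral_affinity[OF this m, of k]
  have "((\<lambda>s. speed A g \<gamma> (?\<phi> s)) has_integral (1 / \<bar>m\<bar>) * len \<gamma> a b) {a'..b'}"
    using inv_im by simp
  from has_integral_mult_right[OF this, of "\<bar>m\<bar>"]
  have "((\<lambda>s. \<bar>m\<bar> * speed A g \<gamma> (?\<phi> s)) has_integral len \<gamma> a b) {a'..b'}" using m by simp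
  then have "(speed A g ?\<delta> has_integral len \<gamma> a b) {a'..b'}"
    by (rule has_integral_spike_finite[of "{a',b'}", rotated 2]) (use sp in auto)
  then show "len ?\<delta> a' b' = len \<gamma> a b" unfolding len_def[of ?\<delta>] by (rule integral_unique)
qed

lemma pw_C1_affine:
  assumes "pw_C1 \<gamma> a b" "0 < m"
  shows "pw_C1 (\<lambda>s. \<gamma> (m * s + k)) ((a - k) / m) ((b - k) / m) \<and>
    len (\<lambda>s. \<gamma> (m * s + k)) ((a - k) / m) ((b - k) / m) = len \<gamma> a b"
  using assms(1)
proof (induction rule: pw_C1.induct)
  case (single a b)
  show ?case using C1_affine[OF single(2), of m k "(a - k) / m" "(b - k) / m"] single assms(2)
    by (auto simp: image_affinity_atLeastAtMost divide_strict_right_mono intro!: pw_C1.single)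
next
  case (snoc a b c)
  have *: "(b - k) / m < (c - k) / m" using snoc assms(2) by (simp add: divide_strict_right_mono)
  note C = C1_affine[OF snoc.hyps(3), of m k "(b - k) / m" "(c - k) / m"]
  have "C1_curve A ((b - k) / m) ((c - k) / m) (\<lambda>s. \<gamma> (m * s + k))"
    "len (\<lambda>s. \<gamma> (m * s + k)) ((b - k) / m) ((c - k) / m) = len \<gamma> b c"
    using C snoc.hyps * assms(2) by (simp_all add: image_affinity_atLeastAtMost)
  then show ?case
    using snoc.IH pw_C1_snoc_len[OF snoc.hyps] pw_C1_snoc_len[OF _ *] pw_C1.snoc[OF _ *] by metis
qed

lemma pw_C1_reverse:
  "pw_C1 \<gamma> a b \<Longrightarrow> pw_C1 (\<lambda>s. \<gamma> (- s)) (- b) (- a) \<and> len (\<lambda>s. \<gamma> (- s)) (- b) (- a) = len \<gamma> a b"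
proof (induction rule: pw_C1.induct)
  case (single a b)
  show ?case using C1_affine[OF single(2), of "-1" 0 "- b" "- a"] single by (auto intro!: pw_C1.single)
next
  case (snoc a b c)
  let ?\<delta> = "\<lambda>s. \<gamma> (- s)"
  have C: "C1_curve A (- c) (- b) ?\<delta>" "len ?\<delta> (- c) (- b) = len \<gamma> b c"
    using C1_affine[OF snoc.hyps(3), of "-1" 0 "- c" "- b"] snoc.hyps(2) by auto
  have p: "pw_C1 ?\<delta> (- c) (- a)"
    by (rule pw_C1_trans[of _ "- b"]) (use snoc.IH snoc.hyps(2) C pw_C1.single in auto)
  then have "len ?\<delta> (- c) (- a) = len ?\<delta> (- c) (- b) + len ?\<delta> (- b) (- a)"
    using pw_C1_less[OF snoc.hyps(1)] snoc.hyps(2) by (intro len_combine pw_C1_integrable) auto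
  then show ?case using p C(2) snoc.IH pw_C1_snoc_len[OF snoc.hyps] by simp
qed

lemma C1_subinterval:
  assumes "C1_curve A a b \<gamma>" "{a'..b'} \<subseteq> {a..b}"
  shows "C1_curve A a' b' \<gamma>"
  unfolding C1_curve_def
proof (intro conjI ballI)
  show "continuous_on {a'..b'} \<gamma>" using assms continuous_on_subset unfolding C1_curve_def by blast
  fix c assume "c \<in> A"
  then obtain D where D: "continuous_on ({a..b} \<inter> \<gamma> -` fst c) D"
    "\<forall>t\<in>{a..b} \<inter> \<gamma> -` fst c. ((snd c \<circ> \<gamma>) has_vector_derivative D t) (at t within {a..b})"
    using assms(1) unfolding C1_curve_def by blast
  show "\<exists>D. continuous_on ({a'..b'} \<inter> \<gamma> -` fst c) D \<and>
      (\<forall>t\<in>{a'..b'} \<inter> \<gamma> -` fst c. ((snd c \<circ> \<gamma>) has_vector_derivative D t) (at t within {a'..b'}))"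
  proof (intro exI conjI ballI)
    show "continuous_on ({a'..b'} \<inter> \<gamma> -` fst c) D"
      by (rule continuous_on_subset[OF D(1)]) (use assms(2) in blast)
    fix t assume t: "t \<in> {a'..b'} \<inter> \<gamma> -` fst c"
    then have "t \<in> {a..b} \<inter> \<gamma> -` fst c" using assms(2) by blast
    then show "((snd c \<circ> \<gamma>) has_vector_derivative D t) (at t within {a'..b'})"
      using has_vector_derivative_within_subset[OF _ assms(2)] D(2) by blast
  qed
qed

lemma pw_C1_split: "pw_C1 \<gamma> a b \<Longrightarrow> a < t \<Longrightarrow> t < b \<Longrightarrow> pw_C1 \<gamma> a t \<and> pw_C1 \<gamma> t b"
proof (induction rule: pw_C1.induct)
  case (single a b)
  then show ?case using C1_subinterval[OF single(2)] by (auto intro!: pw_C1.single)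
next
  case (snoc a b c)
  consider "t < b" | "t = b" | "b < t" by linarith
  then show ?case
  proof cases
    case 1
    then have "pw_C1 \<gamma> a t \<and> pw_C1 \<gamma> t b" using snoc by simp
    then show ?thesis using pw_C1.snoc[OF _ snoc.hyps(2,3)] by blast
  next
    case 2 then show ?thesis using snoc pw_C1.single by blast
  next
    case 3
    then have "C1_curve A b t \<gamma>" "C1_curve A t c \<gamma>"
      using C1_subinterval[OF snoc.hyps(3)] snoc.prems by auto
    then show ?thesis using 3 snoc.prems pw_C1.single pw_C1.snoc[OF snoc.hyps(1)] by blast
  qed
qed

text \<open>
  The parameter interval is left free, which makes curves easy to concatenate and to split; an affine
  reparametrisation to \<open>[0, 1]\<close> shows that the lengths are those in the definition of the distance.
\<close>

definition joins :: "'a \<Rightarrow> 'a \<Rightarrow> real \<Rightarrow> bool" where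
  "joins p q L \<longleftrightarrow> (\<exists>\<gamma> a b. pw_C1 \<gamma> a b \<and> \<gamma> a = p \<and> \<gamma> b = q \<and> len \<gamma> a b = L)"

lemma joinsE:
  assumes "joins p q L"
  obtains \<gamma> a b where "pw_C1 \<gamma> a b" "\<gamma> a = p" "\<gamma> b = q" "len \<gamma> a b = L"
proof -
  from assms obtain \<gamma> a b where "pw_C1 \<gamma> a b \<and> \<gamma> a = p \<and> \<gamma> b = q \<and> len \<gamma> a b = L"
    unfolding joins_def by (elim exE) assumption
  then show thesis by (intro that[of \<gamma> a b]) simp_all
qed

lemma joinsI: "pw_C1 \<gamma> a b \<Longrightarrow> joins (\<gamma> a) (\<gamma> b) (len \<gamma> a b)"
  unfolding joins_def by (rule exI[of _ \<gamma>], rule exI[of _ a], rule exI[of _ b]) simp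

lemma joins_nonneg: "joins p q L \<Longrightarrow> 0 \<le> L"
proof -
  assume "joins p q L"
  then obtain \<gamma> a b where \<gamma>: "pw_C1 \<gamma> a b" "\<gamma> a = p" "\<gamma> b = q" "len \<gamma> a b = L"
    by (rule joinsE)
  have "0 \<le> len \<gamma> a b"
    unfolding len_def by (rule integral_nonneg[OF pw_C1_integrable[OF \<gamma>(1)] speed_nonneg])
  then show ?thesis using \<gamma>(4) by simp
qed

lemma riemannian_dist_joins: "riemannian_dist A g p q = Inf {L. joins p q L}"
proof -
  have "{curve_length A g \<gamma> |\<gamma>. piecewise_C1_curve A \<gamma> \<and> \<gamma> 0 = p \<and> \<gamma> 1 = q} = {L. joins p q L}"
  proof (intro equalityI subsetI)
    fix L assume "L \<in> {L. joins p q L}"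
    then have "joins p q L" by simp
    then obtain \<gamma> a b where \<gamma>: "pw_C1 \<gamma> a b" "\<gamma> a = p" "\<gamma> b = q" "len \<gamma> a b = L"
      by (rule joinsE)
    note lt = pw_C1_less[OF \<gamma>(1)]
    let ?\<delta> = "\<lambda>s. \<gamma> ((b - a) * s + a)"
    have "piecewise_C1_curve A ?\<delta>" "curve_length A g ?\<delta> = L"
      using pw_C1_affine[OF \<gamma>(1), of "b - a" a] lt \<gamma>(4)
      by (simp_all add: piecewise_C1_curve_iff curve_length_def len_def)
    moreover have "?\<delta> 0 = p" "?\<delta> 1 = q" using \<gamma>(2,3) by simp_all
    ultimately have "\<exists>\<delta>. L = curve_length A g \<delta> \<and> piecewise_C1_curve A \<delta> \<and> \<delta> 0 = p \<and> \<delta> 1 = q"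
      by (intro exI[of _ ?\<delta>]) simp
    then show "L \<in> {curve_length A g \<gamma> |\<gamma>. piecewise_C1_curve A \<gamma> \<and> \<gamma> 0 = p \<and> \<gamma> 1 = q}"
      by simp
  next
    fix L assume "L \<in> {curve_length A g \<gamma> |\<gamma>. piecewise_C1_curve A \<gamma> \<and> \<gamma> 0 = p \<and> \<gamma> 1 = q}"
    then obtain \<gamma> where "pw_C1 \<gamma> 0 1" "\<gamma> 0 = p" "\<gamma> 1 = q" "len \<gamma> 0 1 = L"
      unfolding piecewise_C1_curve_iff curve_length_def len_def by blast
    then show "L \<in> {L. joins p q L}" using joinsI[of \<gamma> 0 1] by simp
  qed
  then show ?thesis by (simp add: riemannian_dist_def)
qed

lemma joins_sym: "joins p q L \<Longrightarrow> joins q p L"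
proof -
  assume "joins p q L"
  then obtain \<gamma> a b where \<gamma>: "pw_C1 \<gamma> a b" "\<gamma> a = p" "\<gamma> b = q" "len \<gamma> a b = L"
    by (rule joinsE)
  then show ?thesis
    using pw_C1_reverse[OF \<gamma>(1)] joinsI[of "\<lambda>s. \<gamma> (- s)" "- b" "- a"] by simp
qed

lemma joins_trans:
  assumes "joins p q L1" "joins q r L2"
  shows "joins p r (L1 + L2)"
proof -
  obtain \<gamma> a b where \<gamma>: "pw_C1 \<gamma> a b" "\<gamma> a = p" "\<gamma> b = q" "len \<gamma> a b = L1"
    by (rule joinsE[OF assms(1)])
  obtain \<delta> c d where \<delta>: "pw_C1 \<delta> c d" "\<delta> c = q" "\<delta> d = r" "len \<delta> c d = L2"
    by (rule joinsE[OF assms(2)])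
  let ?\<delta> = "\<lambda>s. \<delta> (s + (c - b))" and ?e = "b + (d - c)"
  let ?\<eta> = "\<lambda>t. if t \<le> b then \<gamma> t else ?\<delta> t"
  have lt: "a < b" "b < ?e" using pw_C1_less[OF \<gamma>(1)] pw_C1_less[OF \<delta>(1)] by auto
  have "pw_C1 ?\<delta> b ?e \<and> len ?\<delta> b ?e = L2"
    using pw_C1_affine[OF \<delta>(1), of 1 "c - b"] \<delta>(4) by (simp add: algebra_simps)
  moreover have "?\<delta> t = ?\<eta> t" if "t \<in> {b..?e}" for t
    using that \<gamma>(3) \<delta>(2) by (cases "t = b") auto
  ultimately have 2: "pw_C1 ?\<eta> b ?e" "len ?\<eta> b ?e = L2"
    using pw_C1_cong[of ?\<delta> b ?e ?\<eta>] by auto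
  have 1: "pw_C1 ?\<eta> a b" "len ?\<eta> a b = L1" using pw_C1_cong[OF \<gamma>(1), of ?\<eta>] \<gamma>(4) by auto
  have p: "pw_C1 ?\<eta> a ?e" by (rule pw_C1_trans[OF 2(1) 1(1)])
  have "len ?\<eta> a ?e = L1 + L2"
    using len_combine[OF pw_C1_integrable[OF p], of b] 1 2 lt by simp
  moreover have "?\<eta> a = p" "?\<eta> ?e = r" using \<gamma>(2) \<delta>(3) lt by auto
  ultimately show ?thesis using joinsI[OF p] by simp
qed

text \<open>
  The length of the initial piece depends continuously on its endpoint, so it takes the value \<open>r\<close>.
\<close>

lemma joins_split:
  assumes "joins p q L" "0 < r" "r < L"
  shows "\<exists>m. joins p m r \<and> joins m q (L - r)"
proof -
  obtain \<gamma> a b where \<gamma>: "pw_C1 \<gamma> a b" "\<gamma> a = p" "\<gamma> b = q" "len \<gamma> a b = L"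
    by (rule joinsE[OF assms(1)])
  note lt = pw_C1_less[OF \<gamma>(1)]
  have "continuous_on {a..b} (\<lambda>t. len \<gamma> a t)"
    unfolding len_def by (rule indefinite_integral_continuous_1[OF pw_C1_integrable[OF \<gamma>(1)]])
  moreover have "len \<gamma> a a = 0" by (simp add: len_def)
  ultimately obtain t where t: "a \<le> t" "t \<le> b" "len \<gamma> a t = r"
    using IVT'[of "\<lambda>t. len \<gamma> a t" a r b] assms lt \<gamma>(4) by auto
  have "t \<noteq> a" "t \<noteq> b" using t(3) assms(2,3) \<gamma>(4) by (auto simp: len_def)
  then have "pw_C1 \<gamma> a t \<and> pw_C1 \<gamma> t b" using pw_C1_split[OF \<gamma>(1), of t] t by auto
  moreover have "len \<gamma> t b = L - r"
    using len_combine[OF pw_C1_integrable[OF \<gamma>(1)] t(1,2)] \<gamma>(4) t(3) by simp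
  ultimately show ?thesis using joinsI[of \<gamma> a t] joinsI[of \<gamma> t b] \<gamma>(2,3) t(3) by auto
qed

text \<open>
  In the chart \<open>c\<close> itself the velocity is constantly \<open>v\<close>; in another chart it is the image of
  \<open>v\<close> under the derivative of the transition map, which is continuous along the segment.
\<close>

lemma chart_segment:
  assumes c: "c \<in> A" and seg: "\<And>t. t \<in> {0..1} \<Longrightarrow> x + t *\<^sub>R v \<in> snd c ` fst c"
    and up: "\<And>t. t \<in> {0..1} \<Longrightarrow> g c (x + t *\<^sub>R v) v v \<le> B\<^sup>2" and B: "0 \<le> B"
  shows "\<exists>L\<le>B. joins (param c x) (param c (x + v)) L"
proof -
  let ?X = "\<lambda>t::real. x + t *\<^sub>R v" and ?\<gamma> = "\<lambda>t::real. param c (x + t *\<^sub>R v)"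
  have X: "(?X has_vector_derivative v) (at t within T)" for t T by (auto intro!: derivative_eq_intros)
  have cont: "continuous_on {0..1} ?\<gamma>"
    by (rule continuous_on_compose2[OF chart(4)[OF c]]) (use seg in \<open>auto intro!: continuous_intros\<close>)
  have inc: "?\<gamma> t \<in> fst c" "snd c (?\<gamma> t) = ?X t" if "t \<in> {0..1}" for t
    using chart(6,7)[OF c seg[OF that]] by auto
  have der: "((snd c \<circ> ?\<gamma>) has_vector_derivative v) (at t within {0..1})" if "t \<in> {0..1}" for t
    by (rule has_vector_derivative_transform[OF that _ X]) (use inc in auto)
  have C: "C1_curve A 0 1 ?\<gamma>"
    unfolding C1_curve_def
  proof (intro conjI ballI cont)
    fix d assume d: "d \<in> A"
    let ?J = "{0..1} \<inter> ?\<gamma> -` fst d"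
    have W: "?X t \<in> snd c ` (fst c \<inter> fst d)" if "t \<in> ?J" for t
    proof -
      have "?X t = snd c (?\<gamma> t)" "?\<gamma> t \<in> fst c \<inter> fst d" using inc that by auto
      then show ?thesis by (metis imageI)
    qed
    show "\<exists>D. continuous_on ?J D \<and>
        (\<forall>t\<in>?J. ((snd d \<circ> ?\<gamma>) has_vector_derivative D t) (at t within {0..1}))"
    proof (intro exI conjI ballI)
      show "continuous_on ?J (\<lambda>t. frechet_derivative (local_rep c d id) (at (?X t)) v)"
        by (rule continuous_on_compose2[OF transition(2)[OF c d]])
          (use W in \<open>auto intro!: continuous_intros\<close>)
      fix t assume t: "t \<in> ?J"
      have "((snd d \<circ> ?\<gamma>) has_vector_derivative
          frechet_derivative (local_rep c d id) (at (snd c (?\<gamma> t))) v) (at t within {0..1})"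
        by (rule chart_change_derivative[OF c _ d]) (use t inc der cont in \<open>auto simp: continuous_on_def\<close>)
      then show "((snd d \<circ> ?\<gamma>) has_vector_derivative
          frechet_derivative (local_rep c d id) (at (?X t)) v) (at t within {0..1})"
        using inc(2)[of t] t by simp
    qed
  qed
  have "speed A g ?\<gamma> t \<le> B" if t: "t \<in> {0<..<1}" for t
  proof -
    have ti: "t \<in> {0..1}" using t by auto
    have "((snd c \<circ> ?\<gamma>) has_vector_derivative v) (at t)" using der[OF ti] t by (simp add: at_within_Icc_at)
    then have "speed A g ?\<gamma> t = sqrt (g c (snd c (?\<gamma> t)) v v)"
      by (rule speed_eq[OF c inc(1)[OF ti] C1_interior(1)[OF C t c inc(1)[OF ti]]])
    then show ?thesis using up[OF ti] inc(2)[OF ti] B by (simp add: real_le_lsqrt)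
  qed
  moreover have "speed A g ?\<gamma> integrable_on {0..1}" by (rule C1_speed_integrable[OF _ C]) simp
  ultimately have "len ?\<gamma> 0 1 \<le> B"
    using len_le[of ?\<gamma> 0 1 "\<lambda>_. B"] integrable_const_ivl[of B 0 "1::real"] by simp
  then show ?thesis
    using joinsI[OF single[OF zero_less_one C]] by auto
qed
end

section \<open>The Riemannian distance and the Hopf--Rinow theorem\<close>

lemma has_real_derivative_max_0_squared:
  "((\<lambda>s::real. (max 0 s)\<^sup>2) has_real_derivative 2 * max 0 s) (at s)"
proof -
  consider "0 < s" | "s < 0" | "s = 0" by linarith
  then show ?thesis
  proof cases
    case 1
    have "((\<lambda>s::real. s\<^sup>2) has_real_derivative 2 * s) (at s)"
      by (auto intro!: derivative_eq_intros)
    then show ?thesis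
      by (subst DERIV_cong_ev[OF refl _ refl, where g = "\<lambda>s. s\<^sup>2"])
        (use 1 in \<open>auto intro: eventually_mono[OF eventually_nhds_in_open[of "{0<..}"]]\<close>)
  next
    case 2
    have "((\<lambda>s::real. 0) has_real_derivative 0) (at s)" by simp
    then show ?thesis
      by (subst DERIV_cong_ev[OF refl _ refl, where g = "\<lambda>s. 0"])
        (use 2 in \<open>auto intro: eventually_mono[OF eventually_nhds_in_open[of "{..<0}"]]\<close>)
  next
    case 3
    have "(\<lambda>h::real. (max 0 h)\<^sup>2 / h) \<midarrow>0\<rightarrow> 0"
    proof (rule Lim_null_comparison[where g = abs])
      show "\<forall>\<^sub>F h::real in at 0. norm ((max 0 h)\<^sup>2 / h) \<le> \<bar>h\<bar>"
        by (rule always_eventually) (auto simp: max_def power2_eq_square)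
      show "abs \<midarrow>0::real\<rightarrow> 0" using tendsto_rabs[OF tendsto_ident_at, of "0::real"] by simp
    qed
    then show ?thesis using 3 by (simp add: DERIV_def)
  qed
qed

context riemannian_manifold begin

lemma chart_ball:
  assumes "c \<in> A" "p \<in> fst c" "open V" "p \<in> V"
  obtains r where "0 < r" "cball (snd c p) r \<subseteq> snd c ` (fst c \<inter> V)"
  using open_contains_cball[of "snd c ` (fst c \<inter> V)"] open_chart_image[OF assms(1,3)] assms(2,4) by blast

lemma short_curves_nearby:
  assumes e: "0 < e"
  shows "\<exists>V. open V \<and> p \<in> V \<and> (\<forall>q\<in>V. \<exists>L<e. joins p q L)"
proof -
  obtain c where c: "c \<in> A" "p \<in> fst c" by (rule chart_at)
  let ?x = "snd c p"
  obtain r where r: "0 < r" "cball ?x r \<subseteq> snd c ` (fst c \<inter> UNIV)"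
    by (rule chart_ball[OF c open_UNIV UNIV_I])
  then have rS: "cball ?x r \<subseteq> snd c ` fst c" by simp
  obtain l B where B: "0 < B" "\<And>x v. x \<in> cball ?x r \<Longrightarrow> g c x v v \<le> B * (norm v)\<^sup>2"
    by (rule metric_field_bounds[OF metric_field_chart[OF c(1)] compact_cball rS]) blast
  define \<rho> where "\<rho> = min r (e / (sqrt B + 1))"
  have sB: "0 < sqrt B + 1" using B(1) by (simp add: add_pos_pos)
  have \<rho>: "0 < \<rho>" "\<rho> \<le> r" "\<rho> \<le> e / (sqrt B + 1)" using r(1) e sB by (simp_all add: \<rho>_def)
  let ?V = "fst c \<inter> snd c -` ball ?x \<rho>"
  have "\<exists>L<e. joins p q L" if q: "q \<in> ?V" for q
  proof -
    let ?v = "snd c q - ?x"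
    have nv: "norm ?v < \<rho>" using q by (simp add: dist_norm norm_minus_commute)
    have seg: "?x + t *\<^sub>R ?v \<in> cball ?x r" if "t \<in> {0..1}" for t
    proof -
      have "\<bar>t\<bar> * norm ?v \<le> 1 * norm ?v" using that by (intro mult_right_mono) auto
      then show ?thesis using nv \<rho>(2) by (simp add: dist_norm)
    qed
    have "\<exists>L\<le>sqrt B * norm ?v. joins (param c ?x) (param c (?x + ?v)) L"
    proof (rule chart_segment[OF c(1)])
      show "?x + t *\<^sub>R ?v \<in> snd c ` fst c" if "t \<in> {0..1}" for t using seg[OF that] rS by blast
      show "g c (?x + t *\<^sub>R ?v) ?v ?v \<le> (sqrt B * norm ?v)\<^sup>2" if "t \<in> {0..1}" for t
        using B(2)[OF seg[OF that], of ?v] B(1) by (simp add: power_mult_distrib)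
      show "0 \<le> sqrt B * norm ?v" using B(1) by simp
    qed
    moreover have "param c ?x = p" "param c (?x + ?v) = q" using chart(5)[OF c(1)] c(2) q by simp_all
    moreover have "sqrt B * norm ?v < e"
    proof -
      have "sqrt B * norm ?v \<le> (sqrt B + 1) * norm ?v" by (intro mult_right_mono) auto
      also have "\<dots> < (sqrt B + 1) * \<rho>" using nv sB by simp
      also have "\<dots> \<le> e" using \<rho>(3) sB by (simp add: field_simps)
      finally show ?thesis .
    qed
    ultimately show ?thesis by (metis order.strict_trans1)
  qed
  moreover have "open ?V" by (rule continuous_open_preimage[OF chart(3)[OF c(1)] chart(1)[OF c(1)] open_ball])
  moreover have "p \<in> ?V" using c(2) \<rho>(1) by simp
  ultimately show ?thesis by blast
qed

text \<open>
  The fundamental theorem of calculus on each piece.  The bound on the differential of \<open>f\<close> is stated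
  for velocities of curves, so that it can be checked in any chart around the point.
\<close>

lemma lipschitz_along_curves:
  assumes f: "continuous_on UNIV f" and C: "0 \<le> C"
    and der: "\<And>\<gamma> t c. c \<in> A \<Longrightarrow> \<gamma> t \<in> fst c \<Longrightarrow> isCont \<gamma> t \<Longrightarrow>
        ((snd c \<circ> \<gamma>) has_vector_derivative velocity c \<gamma> t) (at t) \<Longrightarrow>
        \<exists>D. ((\<lambda>s. f (\<gamma> s)) has_real_derivative D) (at t) \<and>
            \<bar>D\<bar> \<le> C * sqrt (g c (snd c (\<gamma> t)) (velocity c \<gamma> t) (velocity c \<gamma> t))"
    and "joins p q L"
  shows "\<bar>f q - f p\<bar> \<le> C * L"
proof -
  obtain \<gamma> a b where \<gamma>: "pw_C1 \<gamma> a b" "\<gamma> a = p" "\<gamma> b = q" "len \<gamma> a b = L"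
    by (rule joinsE[OF assms(4)])
  have piece: "\<bar>f (\<gamma> b) - f (\<gamma> a)\<bar> \<le> C * len \<gamma> a b" if ab: "a < b" and C1: "C1_curve A a b \<gamma>" for a b
  proof -
    have "\<exists>D. ((\<lambda>s. f (\<gamma> s)) has_real_derivative D) (at t) \<and> \<bar>D\<bar> \<le> C * speed A g \<gamma> t"
      if t: "t \<in> {a<..<b}" for t
    proof -
      obtain c where c: "c \<in> A" "\<gamma> t \<in> fst c" by (rule chart_at)
      show ?thesis
        using der[OF c C1_interior(1,2)[OF C1 t c]] C1_interior(3)[OF C1 t c] by simp
    qed
    then obtain D where D: "\<And>t. t \<in> {a<..<b} \<Longrightarrow> ((\<lambda>s. f (\<gamma> s)) has_real_derivative D t) (at t)"
      "\<And>t. t \<in> {a<..<b} \<Longrightarrow> \<bar>D t\<bar> \<le> C * speed A g \<gamma> t" by metis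
    define D' where "D' t = (if t \<in> {a<..<b} then D t else 0)" for t
    have "(D' has_integral f (\<gamma> b) - f (\<gamma> a)) {a..b}"
    proof (rule fundamental_theorem_of_calculus_interior)
      show "continuous_on {a..b} (\<lambda>t. f (\<gamma> t))"
        by (rule continuous_on_compose2[OF f]) (use C1 in \<open>auto simp: C1_curve_def\<close>)
      show "((\<lambda>t. f (\<gamma> t)) has_vector_derivative D' t) (at t)" if "t \<in> {a<..<b}" for t
        using D(1)[OF that] that by (simp add: D'_def has_real_derivative_iff_has_vector_derivative)
    qed (use ab in simp)
    note I = this
    have S: "(\<lambda>t. C * speed A g \<gamma> t) integrable_on {a..b}"
      using integrable_on_cmult_left[OF C1_speed_integrable[OF ab C1], of C] by simp
    have "norm (integral {a..b} D') \<le> integral {a..b} (\<lambda>t. C * speed A g \<gamma> t)"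
      by (rule Henstock_Kurzweil_Integration.integral_norm_bound_integral[OF has_integral_integrable[OF I] S])
        (use D(2) C speed_nonneg in \<open>auto simp: D'_def\<close>)
    then show ?thesis using integral_unique[OF I] by (simp add: len_def)
  qed
  have "\<bar>f (\<gamma> b) - f (\<gamma> a)\<bar> \<le> C * len \<gamma> a b"
    using \<gamma>(1)
  proof (induction rule: pw_C1.induct)
    case (single a b) then show ?case by (rule piece)
  next
    case (snoc a b c)
    show ?case
      using piece[OF snoc.hyps(2,3)] snoc.IH pw_C1_snoc_len[OF snoc.hyps] by (simp add: distrib_left)
  qed
  then show ?thesis using \<gamma> by simp
qed

text \<open>
  In a chart around \<open>p\<close> with \<open>p\<close> at \<open>x\<close>, the \<open>C\<^sup>1\<close> function \<open>(max 0 (r\<^sup>2 - |y - x|\<^sup>2))\<^sup>2\<close>, extended by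
  \<open>0\<close>, is supported in \<open>V\<close> and its differential is bounded with respect to \<open>g\<close>.  It drops from
  \<open>r\<^sup>4\<close> to \<open>0\<close> along a curve from \<open>p\<close> that ends outside \<open>V\<close>, which takes a definite length.
\<close>

lemma curves_leaving_are_long:
  assumes V: "open V" "p \<in> V"
  shows "\<exists>e>0. \<forall>q L. joins p q L \<longrightarrow> q \<notin> V \<longrightarrow> e \<le> L"
proof -
  obtain c where c: "c \<in> A" "p \<in> fst c" by (rule chart_at)
  let ?x = "snd c p"
  obtain r where r: "0 < r" "cball ?x r \<subseteq> snd c ` (fst c \<inter> V)"
    by (rule chart_ball[OF c V])
  then have rS: "cball ?x r \<subseteq> snd c ` fst c" by blast
  obtain l where l: "0 < l" "\<And>x v. x \<in> cball ?x r \<Longrightarrow> l * (norm v)\<^sup>2 \<le> g c x v v"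
    by (rule metric_field_bounds[OF metric_field_chart[OF c(1)] compact_cball rS]) blast
  define K where "K = param c ` cball ?x r"
  have KV: "K \<subseteq> fst c \<inter> V"
  proof
    fix q assume "q \<in> K"
    then obtain x where x: "q = param c x" "x \<in> cball ?x r" by (auto simp: K_def)
    then obtain q' where "q' \<in> fst c \<inter> V" "x = snd c q'" using r(2) by blast
    then show "q \<in> fst c \<inter> V" using x(1) chart(5)[OF c(1)] by simp
  qed
  have "compact K" unfolding K_def
    by (rule compact_continuous_image[OF continuous_on_subset[OF chart(4)[OF c(1)] rS] compact_cball])
  then have oK: "open (- K)" using compact_imp_closed by blast
  define \<eta> where "\<eta> y = (max 0 (r\<^sup>2 - (y - ?x) \<bullet> (y - ?x)))\<^sup>2" for y
  define f where "f q = (if q \<in> fst c then \<eta> (snd c q) else 0)" for q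
  have f0: "f q = 0" if "q \<notin> K" for q
  proof (cases "q \<in> fst c")
    case True
    have "snd c q \<notin> cball ?x r"
    proof
      assume "snd c q \<in> cball ?x r"
      then have "param c (snd c q) \<in> K" unfolding K_def by blast
      then show False using that chart(5)[OF c(1) True] by simp
    qed
    then have "r < norm (snd c q - ?x)" by (simp add: dist_norm norm_minus_commute)
    then have "r\<^sup>2 < (norm (snd c q - ?x))\<^sup>2" using r(1) by (intro power_strict_mono) auto
    then show ?thesis using True by (simp add: f_def \<eta>_def power2_norm_eq_inner)
  qed (simp add: f_def)
  have "continuous_on (fst c \<union> - K) f"
  proof (rule continuous_on_open_Un)
    show "continuous_on (fst c) f"
    proof (rule continuous_on_eq)
      show "continuous_on (fst c) (\<lambda>q. \<eta> (snd c q))"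
        unfolding \<eta>_def by (intro continuous_intros chart(3)[OF c(1)])
    qed (simp add: f_def)
    show "continuous_on (- K) f"
      by (rule continuous_on_eq[OF continuous_on_const[of _ 0]]) (use f0 in simp)
  qed (use chart(1)[OF c(1)] oK in auto)
  moreover have "fst c \<union> - K = UNIV" using KV by blast
  ultimately have cf: "continuous_on UNIV f" by simp
  \<comment> \<open>The Euclidean gradient of \<open>\<eta>\<close> is at most \<open>2 r\<^sup>2 \<cdot> 2 r\<close>, and \<open>sqrt l |v|\<close> is at most the
    \<open>g\<close>-norm of \<open>v\<close>.\<close>
  define C where "C = 4 * r ^ 3 / sqrt l"
  have C0: "0 < C" using r(1) l(1) by (simp add: C_def)
  have der: "\<exists>D. ((\<lambda>s. f (\<gamma> s)) has_real_derivative D) (at t) \<and>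
      \<bar>D\<bar> \<le> C * sqrt (g d (snd d (\<gamma> t)) (velocity d \<gamma> t) (velocity d \<gamma> t))"
    if d: "d \<in> A" "\<gamma> t \<in> fst d" and cont: "isCont \<gamma> t"
      and dd: "((snd d \<circ> \<gamma>) has_vector_derivative velocity d \<gamma> t) (at t)" for \<gamma> t d
  proof (cases "\<gamma> t \<in> fst c")
    case False
    have ev: "\<forall>\<^sub>F s in nhds t. \<gamma> s \<in> - K"
      using cont False KV oK unfolding isCont_def continuous_at_open
      by (intro topological_tendstoD[OF _ oK]) (auto simp: tendsto_at_iff_tendsto_nhds)
    have "((\<lambda>s. f (\<gamma> s)) has_real_derivative 0) (at t)"
      by (subst DERIV_cong_ev[OF refl _ refl, where g = "\<lambda>_. 0"])
        (use f0 in \<open>auto intro: eventually_mono[OF ev]\<close>)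
    moreover have "0 \<le> C * sqrt (g d (snd d (\<gamma> t)) (velocity d \<gamma> t) (velocity d \<gamma> t))"
      using C0 metric_nonneg[OF d] by simp
    ultimately show ?thesis by (intro exI[of _ 0]) simp
  next
    case True
    note cc = c(1) True
    let ?y = "snd c (\<gamma> t)"
    define v where "v = frechet_derivative (local_rep d c id) (at (snd d (\<gamma> t))) (velocity d \<gamma> t)"
    have cd: "((snd c \<circ> \<gamma>) has_vector_derivative v) (at t)"
      unfolding v_def
      by (rule chart_change_derivative[where I = UNIV and \<gamma> = \<gamma> and t = t, OF d cc])
        (use cont dd in \<open>simp_all add: isCont_def\<close>)
    have gv: "g d (snd d (\<gamma> t)) (velocity d \<gamma> t) (velocity d \<gamma> t) = g c ?y v v"
      unfolding v_def by (rule metric_invariant[OF d cc, symmetric])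
    define m where "m = max 0 (r\<^sup>2 - (?y - ?x) \<bullet> (?y - ?x))"
    define D where "D = 2 * m * (- 2 * ((?y - ?x) \<bullet> v))"
    have ev: "\<forall>\<^sub>F s in nhds t. \<gamma> s \<in> fst c"
      using cont True chart(1)[OF c(1)] unfolding isCont_def
      by (intro topological_tendstoD[of \<gamma> "\<gamma> t"]) (auto simp: tendsto_at_iff_tendsto_nhds)
    have inner: "((\<lambda>s. r\<^sup>2 - (snd c (\<gamma> s) - ?x) \<bullet> (snd c (\<gamma> s) - ?x)) has_real_derivative
        - 2 * ((?y - ?x) \<bullet> v)) (at t)"
    proof -
      have "((\<lambda>s. snd c (\<gamma> s)) has_derivative (\<lambda>s. s *\<^sub>R v)) (at t)"
        using cd by (simp add: has_vector_derivative_def o_def)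
      then show ?thesis unfolding has_field_derivative_def
        by (auto intro!: derivative_eq_intros simp: fun_eq_iff inner_commute algebra_simps)
    qed
    have "((\<lambda>s. \<eta> (snd c (\<gamma> s))) has_real_derivative D) (at t)"
      unfolding \<eta>_def D_def m_def by (rule DERIV_chain2[OF has_real_derivative_max_0_squared inner])
    then have "((\<lambda>s. f (\<gamma> s)) has_real_derivative D) (at t)"
      by (subst DERIV_cong_ev[OF refl _ refl, where g = "\<lambda>s. \<eta> (snd c (\<gamma> s))"])
        (auto simp: f_def intro: eventually_mono[OF ev])
    moreover have "\<bar>D\<bar> \<le> C * sqrt (g c ?y v v)"
    proof (cases "?y \<in> cball ?x r")
      case True
      then have ny: "norm (?y - ?x) \<le> r" by (simp add: dist_norm norm_minus_commute)
      have "m \<le> r\<^sup>2" unfolding m_def by simp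
      moreover have "\<bar>(?y - ?x) \<bullet> v\<bar> \<le> r * norm v"
        using Cauchy_Schwarz_ineq2[of "?y - ?x" v] mult_right_mono[OF ny, of "norm v"] by simp
      ultimately have "\<bar>D\<bar> \<le> 4 * (r\<^sup>2 * (r * norm v))"
        unfolding D_def by (auto simp: abs_mult m_def intro!: mult_mono)
      also have "\<dots> = C * (sqrt l * norm v)" using l(1) by (simp add: C_def power3_eq_cube power2_eq_square)
      also have "sqrt l * norm v \<le> sqrt (g c ?y v v)"
        using real_sqrt_le_mono[OF l(2)[OF True, of v]] by (simp add: real_sqrt_mult)
      finally show ?thesis using C0 by simp
    next
      case False
      then have "r < norm (?y - ?x)" by (simp add: dist_norm norm_minus_commute)
      then have "r\<^sup>2 < (norm (?y - ?x))\<^sup>2" using r(1) by (intro power_strict_mono) auto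
      then have "D = 0" by (simp add: D_def m_def power2_norm_eq_inner)
      then show ?thesis using C0 metric_nonneg[OF cc] by simp
    qed
    ultimately show ?thesis unfolding gv by blast
  qed
  have fp: "f p = r ^ 4" using c(2) r(1) by (simp add: f_def \<eta>_def flip: power_mult)
  have "r ^ 4 / C \<le> L" if "joins p q L" "q \<notin> V" for q L
  proof -
    have "f q = 0" using f0 KV that(2) by blast
    moreover have "\<bar>f q - f p\<bar> \<le> C * L"
    proof (rule lipschitz_along_curves[where f = f and C = C, OF cf _ _ that(1)])
      show "0 \<le> C" using C0 by simp
    qed (rule der)
    ultimately have "\<bar>r ^ 4\<bar> \<le> C * L" using fp by simp
    then show ?thesis using C0 r(1) by (simp add: field_simps)
  qed
  then show ?thesis using C0 r(1) by (intro exI[of _ "r ^ 4 / C"]) simp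
qed
end

locale connected_riemannian_manifold = riemannian_manifold A g
  for A :: "('a::{t2_space, second_countable_topology}, 'e::euclidean_space) chart set" and g +
  assumes connected: "connected (UNIV :: 'a set)"
begin

abbreviation "d \<equiv> riemannian_dist A g"

text \<open>
  The set of points that can be joined to \<open>p\<close> is open and closed, as every point can be joined to
  its neighbours.
\<close>

lemma joinable: "\<exists>L. joins p q L"
proof -
  define S where "S = {q. \<exists>L. joins p q L}"
  have nb: "\<exists>V. open V \<and> q \<in> V \<and> (V \<subseteq> S \<or> V \<subseteq> - S)" for q
  proof -
    obtain V where V: "open V" "q \<in> V" "\<And>q'. q' \<in> V \<Longrightarrow> \<exists>L. joins q q' L"
      using short_curves_nearby[OF zero_less_one, of q] by blast
    have "V \<subseteq> S" if "q \<in> S"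
    proof
      fix q' assume "q' \<in> V"
      then obtain L where L: "joins q q' L" using V(3) by blast
      obtain L' where "joins p q L'" using \<open>q \<in> S\<close> unfolding S_def by blast
      from joins_trans[OF this L] show "q' \<in> S" unfolding S_def by blast
    qed
    moreover have "V \<subseteq> - S" if "q \<notin> S"
    proof
      fix q' assume "q' \<in> V"
      then obtain L where L: "joins q q' L" using V(3) by blast
      have "joins p q (L' + L)" if "joins p q' L'" for L' by (rule joins_trans[OF that joins_sym[OF L]])
      then show "q' \<in> - S" using \<open>q \<notin> S\<close> unfolding S_def by blast
    qed
    ultimately show ?thesis using V(1,2) by blast
  qed
  have "open S" by (subst open_subopen) (use nb in blast)
  moreover have "open (- S)" by (subst open_subopen) (use nb in blast)
  moreover have "S \<noteq> {}"
    unfolding S_def using short_curves_nearby[OF zero_less_one, of p] by blast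
  ultimately have "S = UNIV" using connected unfolding connected_clopen closed_def by auto
  then have "q \<in> S" by simp
  then show ?thesis unfolding S_def by blast
qed

lemma dist_less_iff: "d p q < e \<longleftrightarrow> (\<exists>L<e. joins p q L)"
proof -
  have "bdd_below {L. joins p q L}" using joins_nonneg by (meson bdd_belowI mem_Collect_eq)
  then show ?thesis unfolding riemannian_dist_joins
    using cInf_less_iff[of "{L. joins p q L}" e] joinable[of p q] by auto
qed

lemma dist_nonneg: "0 \<le> d p q"
proof (rule ccontr)
  assume "\<not> 0 \<le> d p q"
  then have "d p q < 0" by simp
  then obtain L where "L < 0" "joins p q L" unfolding dist_less_iff by blast
  then show False using joins_nonneg[of p q L] by simp
qed

sublocale Metric_space UNIV d
proof
  show "0 \<le> d p q" for p q by (rule dist_nonneg)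
  show "d p q = d q p" for p q
  proof -
    have "joins p q = joins q p" by (intro ext iffI) (erule joins_sym)+
    then show ?thesis by (simp add: riemannian_dist_joins)
  qed
  show "d p q = 0 \<longleftrightarrow> p = q" for p q
  proof
    show "p = q" if "d p q = 0"
    proof (rule ccontr)
      assume "p \<noteq> q"
      then obtain e where e: "0 < e" "\<And>L. joins p q L \<Longrightarrow> e \<le> L"
        using curves_leaving_are_long[of "- {q}" p] by auto
      then have "d p q < e" using that by simp
      then show False using e(2) unfolding dist_less_iff by force
    qed
    show "d p q = 0" if "p = q"
    proof (rule ccontr)
      assume "d p q \<noteq> 0"
      then have "0 < d p p" using dist_nonneg[of p q] that by simp
      from short_curves_nearby[OF this, of p] have "d p p < d p p" unfolding dist_less_iff by blast
      then show False by simp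
    qed
  qed
  show "d p r \<le> d p q + d q r" for p q r
  proof (rule field_le_epsilon)
    fix e :: real assume "0 < e"
    then have "d p q < d p q + e / 2" "d q r < d q r + e / 2" by auto
    then obtain L1 L2 where "joins p q L1" "L1 < d p q + e / 2" "joins q r L2" "L2 < d q r + e / 2"
      unfolding dist_less_iff by blast
    then have "joins p r (L1 + L2)" "L1 + L2 < d p q + d q r + e" using joins_trans by auto
    then show "d p r \<le> d p q + d q r + e" using dist_less_iff[of p r "d p q + d q r + e"] by auto
  qed
qed

lemma mtopology_eq_euclidean: "mtopology = euclidean"
proof (rule topology_eq[THEN iffD2], intro allI iffI)
  fix U :: "'a set"
  assume U: "openin mtopology U"
  have "\<exists>V. open V \<and> p \<in> V \<and> V \<subseteq> U" if p: "p \<in> U" for p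
  proof -
    obtain e where e: "0 < e" "mball p e \<subseteq> U" using U p unfolding openin_mtopology by blast
    obtain V where V: "open V" "p \<in> V" "\<And>q. q \<in> V \<Longrightarrow> \<exists>L<e. joins p q L"
      using short_curves_nearby[OF e(1), of p] by blast
    have "V \<subseteq> mball p e"
    proof
      fix q assume "q \<in> V"
      then have "d p q < e" using V(3) unfolding dist_less_iff by blast
      then show "q \<in> mball p e" by simp
    qed
    then show ?thesis using V e(2) by blast
  qed
  then have "open U" by (subst open_subopen) blast
  then show "openin euclidean U" by simp
next
  fix U :: "'a set"
  assume "openin euclidean U"
  then have U: "open U" by simp
  show "openin mtopology U"
    unfolding openin_mtopology
  proof (intro conjI allI impI)
    fix p assume "p \<in> U"
    then obtain e where e: "0 < e" "\<And>q L. joins p q L \<Longrightarrow> q \<notin> U \<Longrightarrow> e \<le> L"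
      using curves_leaving_are_long[OF U] by blast
    have "mball p e \<subseteq> U"
    proof
      fix q assume "q \<in> mball p e"
      then have "d p q < e" by simp
      then obtain L where "L < e" "joins p q L" unfolding dist_less_iff by blast
      then show "q \<in> U" using e(2)[of q L] by force
    qed
    then show "\<exists>r>0. mball p r \<subseteq> U" using e(1) by blast
  qed simp
qed

text \<open>
  Cutting a curve from \<open>x\<close> to \<open>y\<close> of length less than \<open>r + s\<close> at arc length \<open>r\<close> provides the
  point in between that Cohn-Vossen's theorem asks for.
\<close>

theorem hopf_rinow:
  assumes "complete_riemannian A g"
  shows "compact {q. d p q \<le> r}"
proof -
  have "compactin mtopology (mcball p r)"
  proof (rule proper_if_complete_locally_compact_length)
    show mcomplete using assms by (simp add: complete_riemannian_def)
    show "\<exists>e>0. compactin mtopology (mcball q e)" for q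
    proof -
      obtain c where c: "c \<in> A" "q \<in> fst c" by (rule chart_at)
      obtain s where s: "0 < s" "cball (snd c q) s \<subseteq> snd c ` (fst c \<inter> UNIV)"
        by (rule chart_ball[OF c open_UNIV UNIV_I])
      then have sS: "cball (snd c q) s \<subseteq> snd c ` fst c" by simp
      let ?K = "param c ` cball (snd c q) s" and ?V = "fst c \<inter> snd c -` ball (snd c q) s"
      have K: "compact ?K"
        by (rule compact_continuous_image[OF continuous_on_subset[OF chart(4)[OF c(1)] sS] compact_cball])
      have "?V \<subseteq> ?K"
      proof
        fix x assume "x \<in> ?V"
        then have "x = param c (snd c x)" "snd c x \<in> cball (snd c q) s" using chart(5)[OF c(1)] by auto
        then show "x \<in> ?K" by blast
      qed
      moreover have "openin mtopology ?V" unfolding mtopology_eq_euclidean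
        using continuous_open_preimage[OF chart(3)[OF c(1)] chart(1)[OF c(1)] open_ball] by simp
      moreover have "q \<in> ?V" using c(2) s(1) by simp
      ultimately obtain e where "0 < e" "mcball q e \<subseteq> ?K" unfolding openin_mtopology_mcball by blast
      moreover have "compactin mtopology ?K" using K by (simp add: mtopology_eq_euclidean)
      ultimately show ?thesis using closed_compactin[OF _ _ closedin_mcball] by blast
    qed
    show "\<exists>z\<in>UNIV. d x z \<le> r \<and> d z y < s" if "0 < r" "0 < s" "d x y < r + s" for x y r s
    proof -
      obtain L where L: "joins x y L" "L < r + s" using \<open>d x y < r + s\<close> unfolding dist_less_iff by blast
      show ?thesis
      proof (cases "r < L")
        case True
        obtain m where m: "joins x m r" "joins m y (L - r)" using joins_split[OF L(1) \<open>0 < r\<close> True] by blast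
        have "d m y < s" using m(2) L(2) unfolding dist_less_iff by (intro exI[of _ "L - r"]) simp
        moreover have "d x m \<le> r"
        proof (rule ccontr)
          assume "\<not> d x m \<le> r"
          then show False using dist_less_iff[of x m "d x m"] m(1) by auto
        qed
        ultimately show ?thesis by blast
      next
        case False
        have "d x y \<le> r"
        proof (rule ccontr)
          assume "\<not> d x y \<le> r"
          then show False using dist_less_iff[of x y "d x y"] L(1) False by auto
        qed
        then show ?thesis using \<open>0 < s\<close> by (intro bexI[of _ y]) auto
      qed
    qed
  qed simp
  moreover have "mcball p r = {q. d p q \<le> r}" by auto
  ultimately show ?thesis by (simp add: mtopology_eq_euclidean)
qed
end

section \<open>Subharmonic functions on complete manifolds\<close>

context connected_riemannian_manifold begin

text \<open>
  \<open>D1\<close> and \<open>D2\<close> are the first and second derivative of \<open>f\<close> in the chart \<open>c\<close>, so that the traced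
  form is the Hessian of \<open>f\<close>.  A single chart around each point suffices, and the chart
  may be shrunk to \<open>S\<close>, for instance to fit a chart of the target of a map.
\<close>

definition subharmonic :: "('a \<Rightarrow> real) \<Rightarrow> bool" where
  "subharmonic f \<longleftrightarrow> (\<forall>p. \<exists>c\<in>A. \<exists>S D1 D2. p \<in> fst c \<and> open S \<and> snd c p \<in> S \<and> S \<subseteq> snd c ` fst c \<and>
     (\<forall>x\<in>S. ((\<lambda>y. f (param c y)) has_derivative D1 x) (at x) \<and>
        (\<forall>w. ((\<lambda>y. D1 y w) has_derivative (\<lambda>v. D2 x v w)) (at x)) \<and>
        0 \<le> metric_trace (g c x) (\<lambda>v w. D2 x v w - D1 x (christoffel (g c) x v w))))"

theorem subharmonic_vanishing_at_infinity:
  assumes complete: "complete_riemannian A g" and noncompact: "\<not> compact (UNIV :: 'a set)"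
    and cont: "continuous_on UNIV f" and sub: "subharmonic f"
    and ge: "\<And>p. u\<^sub>0 \<le> f p"
    and lim: "(f \<longlongrightarrow> u\<^sub>0) (filtercomap (\<lambda>p. d p p\<^sub>0) at_top)"
  shows "f p = u\<^sub>0"
proof (rule ccontr)
  assume "f p \<noteq> u\<^sub>0"
  then have "u\<^sub>0 < f p" using ge[of p] by simp
  from order_tendstoD(2)[OF lim this] obtain R where R: "\<And>q. R \<le> d q p\<^sub>0 \<Longrightarrow> f q < f p"
    unfolding eventually_filtercomap_at_top_linorder by blast
  define K where "K = {q. d p\<^sub>0 q \<le> R}"
  have K: "compact K" unfolding K_def by (rule hopf_rinow[OF complete])
  have out: "f q < f p" if "q \<notin> K" for q
    using R[of q] that commute[of q p\<^sub>0] by (simp add: K_def)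
  have "p \<in> K" using out by blast
  then obtain m where m: "m \<in> K" "\<And>q. q \<in> K \<Longrightarrow> f q \<le> f m"
    using continuous_attains_sup[OF K _ continuous_on_subset[OF cont]] by blast
  have fpm: "f p \<le> f m" using m(2) \<open>p \<in> K\<close> .
  have max: "f q \<le> f m" for q
    using m(2)[of q] out[of q] fpm by (cases "q \<in> K") auto
  define Z where "Z = {q. f q = f m}"
  have "closed Z"
    unfolding Z_def using continuous_closed_preimage_constant[OF cont closed_UNIV] by simp
  moreover have "open Z"
  proof (subst open_subopen, rule ballI)
    fix q assume "q \<in> Z"
    then have fq: "f q = f m" by (simp add: Z_def)
    obtain c S D1 D2 where c: "c \<in> A" "q \<in> fst c" and S: "open S" "snd c q \<in> S" "S \<subseteq> snd c ` fst c"
      and D: "\<forall>x\<in>S. ((\<lambda>y. f (param c y)) has_derivative D1 x) (at x) \<and>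
        (\<forall>w. ((\<lambda>y. D1 y w) has_derivative (\<lambda>v. D2 x v w)) (at x)) \<and>
        0 \<le> metric_trace (g c x) (\<lambda>v w. D2 x v w - D1 x (christoffel (g c) x v w))"
      using sub[unfolded subharmonic_def, rule_format, of q] by (elim bexE exE conjE) blast
    have "\<exists>\<rho>>0. \<forall>x\<in>ball (snd c q) \<rho>. f (param c x) = f m"
    proof (rule strong_maximum_principle_metric[where G = "g c" and S = S and ?D1.0 = D1 and ?D2.0 = D2])
      show "metric_field S (g c)" by (rule metric_field_subset[OF metric_field_chart[OF c(1)] S(1,3)])
      show "f (param c (snd c q)) = f m" using chart(5)[OF c] fq by simp
    qed (use D S(2) max in auto)
    then obtain \<rho> where \<rho>: "0 < \<rho>" "\<forall>x\<in>ball (snd c q) \<rho>. f (param c x) = f m" by blast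
    let ?V = "fst c \<inter> snd c -` ball (snd c q) \<rho>"
    have "open ?V" by (rule continuous_open_preimage[OF chart(3)[OF c(1)] chart(1)[OF c(1)] open_ball])
    moreover have "q \<in> ?V" using c(2) \<rho>(1) by simp
    moreover have "?V \<subseteq> Z"
    proof
      fix q' assume q': "q' \<in> ?V"
      then have "f (param c (snd c q')) = f m" using \<rho>(2) by blast
      then show "q' \<in> Z" using q' chart(5)[OF c(1)] by (simp add: Z_def)
    qed
    ultimately show "\<exists>T. open T \<and> q \<in> T \<and> T \<subseteq> Z" by blast
  qed
  moreover have "Z \<noteq> {}" by (auto simp: Z_def)
  ultimately have "Z = UNIV" using connected unfolding connected_clopen by auto
  then have eq: "f q = f m" for q unfolding Z_def by blast
  have "\<not> f q < f p" for q using eq[of q] fpm by linarith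
  then have "q \<in> K" for q using out by blast
  then have "K = UNIV" by blast
  then show False using K noncompact by simp
qed
end

section \<open>The null coordinate of a submanifold of the wave\<close>

locale plane_fronted_wave_chart =
  fixes AM :: "('m::{t2_space, second_countable_topology}, 'f::euclidean_space) chart set"
    and gM :: "('m, 'f) metric_tensor" and H :: "real \<Rightarrow> 'm \<Rightarrow> real" and c :: "('m, 'f) chart"
  assumes wave: "plane_fronted_wave AM gM H" and c: "c \<in> AM"
begin

sublocale M: riemannian_manifold AM gM
  using wave by unfold_locales (auto simp: plane_fronted_wave_def)

abbreviation h :: "real \<times> real \<times> 'f \<Rightarrow> real \<times> real \<times> 'f \<Rightarrow> real \<times> real \<times> 'f \<Rightarrow> real" where
  "h \<equiv> pfw_metric H gM (pfw_chart c)"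

abbreviation S :: "(real \<times> real \<times> 'f) set" where
  "S \<equiv> UNIV \<times> UNIV \<times> snd c ` fst c"

lemmas gM = metric_fieldD[OF M.metric_field_chart[OF c]]

lemma h_eq: "h z V W =
    H (fst z) (M.param c (snd (snd z))) * fst V * fst W + fst V * fst (snd W) + fst (snd V) * fst W +
    gM c (snd (snd z)) (snd (snd V)) (snd (snd W))"
  by (cases z, cases "snd z", cases V, cases "snd V", cases W, cases "snd W")
    (simp add: pfw_metric_pfw_chart)

lemma bilinear_h: "z \<in> S \<Longrightarrow> bilinear (h z)"
  unfolding bilinear_def h_eq using gM(2)[of "snd (snd z)"]
  by (auto intro!: linearI simp: bilinear_ladd bilinear_radd bilinear_lmul bilinear_rmul algebra_simps)

lemma sym_h: "z \<in> S \<Longrightarrow> h z V W = h z W V"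
  unfolding h_eq using gM(3)[of "snd (snd z)" "snd (snd V)" "snd (snd W)"] by (auto simp: algebra_simps)

lemma h_partial_v: "z \<in> S \<Longrightarrow> h z V partial_v = fst V"
  unfolding h_eq using bilinear_rzero[OF gM(2)[of "snd (snd z)"]] by (auto simp: partial_v_def)

lemma nondegenerate_h:
  assumes z: "z \<in> S" and "\<And>W. h z V W = 0"
  shows "V = 0"
proof -
  have b: "bilinear (gM c (snd (snd z)))" using gM(2) z by auto
  have 1: "fst V = 0" using assms(2)[of partial_v] h_partial_v[OF z] by simp
  have 2: "fst (snd V) = 0"
    using assms(2)[of "(1, 0, 0)"] 1 bilinear_rzero[OF b] unfolding h_eq by simp
  have "gM c (snd (snd z)) (snd (snd V)) (snd (snd V)) = 0"
    using assms(2)[of "(0, 0, snd (snd V))"] 1 unfolding h_eq by simp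
  then have "snd (snd V) = 0" using gM(4)[of "snd (snd z)" "snd (snd V)"] z by force
  with 1 2 show ?thesis by (simp add: prod_eq_iff)
qed

text \<open>
  The coefficients of the metric do not depend on \<open>v\<close>: they factor through \<open>(u, v, y) \<mapsto> (u, y)\<close>, and so
  do their derivatives.
\<close>

lemma h_derivative:
  assumes z: "z \<in> S"
  shows "\<exists>D. linear D \<and> ((\<lambda>z. h z V W) has_derivative (\<lambda>U. D (fst U, snd (snd U)))) (at z)"
proof -
  let ?P = "\<lambda>z :: real \<times> real \<times> 'f. (fst z, snd (snd z))"
  define \<phi> where "\<phi> y = H (fst y) (M.param c (snd y)) * (fst V * fst W) +
      (fst V * fst (snd W) + fst (snd V) * fst W) + gM c (snd y) (snd (snd V)) (snd (snd W))" for y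
  have "smooth_on (UNIV \<times> snd c ` fst c) (\<lambda>(u, y). H u (M.param c y))"
    using wave c by (simp add: plane_fronted_wave_def)
  then have "Ck_on 1 (UNIV \<times> snd c ` fst c) (\<lambda>(u, y). H u (M.param c y))"
    unfolding smooth_on_def by blast
  then have 1: "(\<lambda>y. H (fst y) (M.param c (snd y))) differentiable (at (?P z))"
    using z by (auto simp: case_prod_beta')
  have "(\<lambda>y. gM c y (snd (snd V)) (snd (snd W))) differentiable (at (snd (?P z)))"
    using gM(5) z by auto
  then have 2: "(\<lambda>y. gM c (snd y) (snd (snd V)) (snd (snd W))) differentiable (at (?P z))"
    using differentiable_chain_at[of snd "?P z" "\<lambda>y. gM c y (snd (snd V)) (snd (snd W))"]
      bounded_linear_imp_differentiable[OF bounded_linear_snd, of "at (?P z)"]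
    by (simp add: o_def)
  have "\<phi> differentiable (at (?P z))"
    unfolding \<phi>_def by (intro differentiable_add differentiable_mult 1 2 differentiable_const)
  then obtain D where D: "(\<phi> has_derivative D) (at (?P z))" unfolding differentiable_def by blast
  have "(?P has_derivative ?P) (at z)" by (auto intro!: derivative_eq_intros)
  from has_derivative_compose[OF this, where g = \<phi> and g' = D] D
  have "((\<lambda>z. \<phi> (?P z)) has_derivative (\<lambda>U. D (?P U))) (at z)" by blast
  moreover have "(\<lambda>z. \<phi> (?P z)) = (\<lambda>z. h z V W)" unfolding h_eq \<phi>_def by (auto simp: algebra_simps)
  ultimately have "((\<lambda>z. h z V W) has_derivative (\<lambda>U. D (?P U))) (at z)" by simp
  then show ?thesis using has_derivative_linear[OF D] by (intro exI[of _ D]) simp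
qed

text \<open>
  The \<open>u\<close>-component of a vector is its product with \<open>\<partial>\<^sub>v\<close>, so by the Koszul formula it involves
  derivatives of \<open>h(V, \<partial>\<^sub>v)\<close> and \<open>h(W, \<partial>\<^sub>v)\<close>, which are constant, and the derivative of \<open>h(V, W)\<close> in
  the direction \<open>\<partial>\<^sub>v\<close>, in which \<open>h\<close> does not change.
\<close>

lemma christoffel_u_component:
  assumes z: "z \<in> S"
  shows "fst (christoffel h z V W) = 0"
proof -
  let ?\<Gamma> = "christoffel h z" and ?e = "partial_v :: real \<times> real \<times> 'f"
  have oS: "open S" by (intro open_Times open_UNIV gM(1))
  have diff: "(\<lambda>y. h y V W) differentiable (at z)" for V W
    using h_derivative[OF z] unfolding differentiable_def by blast
  have "levi_civita_at h z ?\<Gamma>"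
    unfolding christoffel_def
    by (rule theI'[OF levi_civita_at_ex1[OF oS z bilinear_h sym_h diff nondegenerate_h[OF z]]])
  then have sym: "\<And>V W. ?\<Gamma> V W = ?\<Gamma> W V"
    and lc: "\<And>U V W. frechet_derivative (\<lambda>y. h y V W) (at z) U = h z (?\<Gamma> U V) W + h z V (?\<Gamma> U W)"
    unfolding levi_civita_at_def by blast+
  have 1: "h z V (?\<Gamma> U ?e) = - fst (?\<Gamma> U V)" for U V
  proof -
    have "((\<lambda>y. h y V ?e) has_derivative (\<lambda>_. 0)) (at z)"
      by (rule has_derivative_transform_within_open[OF has_derivative_const oS z])
        (simp add: h_partial_v)
    from frechet_derivative_at[OF this] have "0 = h z (?\<Gamma> U V) ?e + h z V (?\<Gamma> U ?e)"
      using lc[of V ?e U] by metis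
    then show ?thesis using h_partial_v[OF z] by simp
  qed
  have 2: "h z (?\<Gamma> ?e V) W + h z V (?\<Gamma> ?e W) = 0" for V W
  proof -
    obtain D where D: "linear D" "((\<lambda>z. h z V W) has_derivative (\<lambda>U. D (fst U, snd (snd U)))) (at z)"
      using h_derivative[OF z] by blast
    have "0 = frechet_derivative (\<lambda>z. h z V W) (at z) ?e"
      using fun_cong[OF frechet_derivative_at[OF D(2)], of ?e] linear_0[OF D(1)]
      by (simp add: partial_v_def zero_prod_def)
    then show ?thesis unfolding lc by simp
  qed
  have "h z (?\<Gamma> ?e V) W = - fst (?\<Gamma> V W)"
    using 1[of W V] sym_h[OF z] sym[of ?e V] by metis
  moreover have "h z V (?\<Gamma> ?e W) = - fst (?\<Gamma> V W)"
    using 1[of V W] sym[of ?e W] sym[of V W] by metis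
  ultimately show ?thesis using 2[of V W] by simp
qed

lemma second_fundamental_form_u_component:
  assumes "F x \<in> S"
  shows "fst (second_fundamental_form G h F (\<lambda>_. v) (\<lambda>_. w) x) =
    fst (frechet_derivative (\<lambda>y. frechet_derivative F (at y) w) (at x) v) -
    fst (frechet_derivative F (at x) (christoffel G x v w))"
proof -
  have "frechet_derivative id (at x) = id"
    using frechet_derivative_at[OF has_derivative_id] by (simp add: id_def)
  then show ?thesis
    using christoffel_u_component[OF assms]
    by (simp add: second_fundamental_form_def cov_deriv_along_def)
qed
end

text \<open>
  By the vanishing of the \<open>u\<close>-component of the Christoffel symbols, the \<open>u\<close>-component of the
  second fundamental form is the Hessian of \<open>\<mu> = u \<circ> \<psi>\<close>; taking traces gives \<open>\<Delta>\<mu> = k \<langle>H, \<partial>\<^sub>v\<rangle>\<close>.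
  The factor \<open>\<sigma>\<close> allows for \<open>-\<mu>\<close>.
\<close>

theorem u_component_subharmonic:
  fixes A :: "('s::{t2_space, second_countable_topology}, 'e::euclidean_space) chart set"
    and g :: "('s, 'e) metric_tensor"
    and AM :: "('m::{t2_space, second_countable_topology}, 'f::euclidean_space) chart set"
  assumes wave: "plane_fronted_wave AM gM H"
    and A: "smooth_atlas A" "connected (UNIV :: 's set)"
    and sub: "spacelike_submanifold A g (pfw_atlas AM) (pfw_metric H gM) \<psi>"
    and curv: "\<And>c d p. c \<in> A \<Longrightarrow> d \<in> pfw_atlas AM \<Longrightarrow> p \<in> fst c \<inter> \<psi> -` fst d \<Longrightarrow>
        0 \<le> \<sigma> * pfw_metric H gM d (snd d (\<psi> p))
               (mean_curvature_vector g (pfw_metric H gM) \<psi> c d p) partial_v"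
  shows "connected_riemannian_manifold A g" "connected_riemannian_manifold.subharmonic A g (\<lambda>p. \<sigma> * fst (\<psi> p))"
proof -
  show *: "connected_riemannian_manifold A g"
    using A sub by unfold_locales (auto simp: spacelike_submanifold_def)
  interpret connected_riemannian_manifold A g by (rule *)
  have smooth: "smooth_map A (pfw_atlas AM) \<psi>"
    using sub by (simp add: spacelike_submanifold_def immersion_def)
  show "subharmonic (\<lambda>p. \<sigma> * fst (\<psi> p))"
    unfolding subharmonic_def
  proof
    fix p
    obtain c where c: "c \<in> A" "p \<in> fst c" by (rule chart_at)
    have "snd (snd (\<psi> p)) \<in> (\<Union>c\<in>AM. fst c)"
      using wave by (simp add: plane_fronted_wave_def smooth_atlas_def)
    then obtain cM where cM: "cM \<in> AM" "snd (snd (\<psi> p)) \<in> fst cM" by blast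
    interpret W: plane_fronted_wave_chart AM gM H cM using wave cM(1) by unfold_locales
    define dM where "dM = pfw_chart cM"
    have dM: "dM \<in> pfw_atlas AM" "fst dM = UNIV \<times> UNIV \<times> fst cM"
      "\<And>q. snd dM q = (fst q, fst (snd q), snd cM (snd (snd q)))"
      using cM(1) by (auto simp: dM_def pfw_atlas_def pfw_chart_def case_prod_beta')
    define F where "F = local_rep c dM \<psi>"
    define T where "T = snd c ` (fst c \<inter> \<psi> -` fst dM)"
    have "open (\<psi> -` fst dM)"
    proof (rule open_vimage)
      show "open (fst dM)" unfolding dM(2) by (intro open_Times open_UNIV W.M.chart(1)[OF cM(1)])
      show "continuous_on UNIV \<psi>" using smooth by (simp add: smooth_map_def)
    qed
    then have oT: "open T" unfolding T_def by (rule open_chart_image[OF c(1)])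
    have pT: "snd c p \<in> T" unfolding T_def using c(2) cM(2) dM(2) by (cases "\<psi> p") auto
    have TU: "T \<subseteq> snd c ` fst c" by (auto simp: T_def)
    have point: "param c x \<in> fst c \<inter> \<psi> -` fst dM" "snd c (param c x) = x" if "x \<in> T" for x
    proof -
      obtain q where "q \<in> fst c \<inter> \<psi> -` fst dM" "x = snd c q" using \<open>x \<in> T\<close> unfolding T_def by blast
      then show "param c x \<in> fst c \<inter> \<psi> -` fst dM" "snd c (param c x) = x"
        using chart(5)[OF c(1)] by simp_all
    qed
    have Fx: "F x = snd dM (\<psi> (param c x))" for x by (simp add: F_def local_rep_def)
    have "smooth_on T F" unfolding T_def F_def using smooth c(1) dM(1) by (simp add: smooth_map_def)
    then have C2: "Ck_on (Suc (Suc 0)) T F" unfolding smooth_on_def by blast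
    define DF where "DF x = frechet_derivative F (at x)" for x
    define DDF where "DDF x w = frechet_derivative (\<lambda>y. DF y w) (at x)" for x w
    have DF: "(F has_derivative DF x) (at x)" and DDF: "((\<lambda>y. DF y w) has_derivative DDF x w) (at x)"
      if "x \<in> T" for x w
      using C2 that unfolding DF_def DDF_def by (simp_all add: frechet_derivative_works)
    let ?D1 = "\<lambda>x v. \<sigma> * fst (DF x v)" and ?D2 = "\<lambda>x v w. \<sigma> * fst (DDF x w v)"
    have "((\<lambda>y. \<sigma> * fst (\<psi> (param c y))) has_derivative ?D1 x) (at x)" if "x \<in> T" for x
    proof -
      have "(\<lambda>y. \<sigma> * fst (\<psi> (param c y))) = (\<lambda>y. \<sigma> * fst (F y))" by (simp add: Fx dM(3))
      then show ?thesis using DF[OF that] by (auto intro!: derivative_eq_intros)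
    qed
    moreover have "((\<lambda>y. ?D1 y w) has_derivative (\<lambda>v. ?D2 x v w)) (at x)" if "x \<in> T" for x w
      using DDF[OF that, of w] by (auto intro!: derivative_eq_intros)
    moreover have "0 \<le> metric_trace (g c x) (\<lambda>v w. ?D2 x v w - ?D1 x (christoffel (g c) x v w))"
      if x: "x \<in> T" for x
    proof -
      let ?p = "param c x" and ?II = "\<lambda>v w. second_fundamental_form (g c) (pfw_metric H gM dM) F (\<lambda>_. v) (\<lambda>_. w) x"
      have FS: "F x \<in> W.S" using point(1)[OF x] unfolding Fx dM by (cases "\<psi> ?p") auto
      have "fst (?II v w) = fst (DDF x w v) - fst (DF x (christoffel (g c) x v w))" for v w
        unfolding dM_def DF_def DDF_def by (rule W.second_fundamental_form_u_component) (rule FS)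
      then have "metric_trace (g c x) (\<lambda>v w. ?D2 x v w - ?D1 x (christoffel (g c) x v w)) =
          \<sigma> * fst (metric_trace (g c x) ?II)"
        by (simp add: metric_trace_frame fst_sum sum_distrib_left right_diff_distrib)
      also have "\<dots> = real DIM('e) * (\<sigma> * fst (mean_curvature_vector g (pfw_metric H gM) \<psi> c dM ?p))"
        using point(2)[OF x] by (simp add: mean_curvature_vector_def F_def)
      also have "fst (mean_curvature_vector g (pfw_metric H gM) \<psi> c dM ?p) =
          pfw_metric H gM dM (snd dM (\<psi> ?p)) (mean_curvature_vector g (pfw_metric H gM) \<psi> c dM ?p) partial_v"
        using W.h_partial_v[OF FS] by (simp add: Fx dM_def)
      finally show ?thesis using curv[OF c(1) dM(1) point(1)[OF x]] by simp
    qed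
    ultimately have "\<exists>S D1 D2. p \<in> fst c \<and> open S \<and> snd c p \<in> S \<and> S \<subseteq> snd c ` fst c \<and>
     (\<forall>x\<in>S. ((\<lambda>y. \<sigma> * fst (\<psi> (param c y))) has_derivative D1 x) (at x) \<and>
        (\<forall>w. ((\<lambda>y. D1 y w) has_derivative (\<lambda>v. D2 x v w)) (at x)) \<and>
        0 \<le> metric_trace (g c x) (\<lambda>v w. D2 x v w - D1 x (christoffel (g c) x v w)))"
      using c(2) oT pT TU by (intro exI[of _ T] exI[of _ ?D1] exI[of _ ?D2]) auto
    then show "\<exists>c\<in>A. \<exists>S D1 D2. p \<in> fst c \<and> open S \<and> snd c p \<in> S \<and> S \<subseteq> snd c ` fst c \<and>
     (\<forall>x\<in>S. ((\<lambda>y. \<sigma> * fst (\<psi> (param c y))) has_derivative D1 x) (at x) \<and>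
        (\<forall>w. ((\<lambda>y. D1 y w) has_derivative (\<lambda>v. D2 x v w)) (at x)) \<and>
        0 \<le> metric_trace (g c x) (\<lambda>v w. D2 x v w - D1 x (christoffel (g c) x v w)))"
      using c(1) by blast
  qed
qed

theorem theorem7:
  fixes AM :: "('m::{t2_space, second_countable_topology}, real^'n) chart set"
    and gM :: "('m, real^'n) metric_tensor"
    and H :: "real \<Rightarrow> 'm \<Rightarrow> real"
    and A :: "('s::{t2_space, second_countable_topology}, real^'k) chart set"
    and g :: "('s, real^'k) metric_tensor"
    and \<psi> :: "'s \<Rightarrow> real \<times> real \<times> 'm"
    and p\<^sub>0 :: 's
    and u\<^sub>0 :: real
  assumes "plane_fronted_wave AM gM H"
    and "smooth_atlas A" and "connected (UNIV :: 's set)"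
    and "spacelike_submanifold A g (pfw_atlas AM) (pfw_metric H gM) \<psi>"
    and "complete_riemannian A g"
    and "orientable A"
    and "\<not> compact (UNIV :: 's set)"
  shows "((\<forall>c\<in>A. \<forall>d\<in>pfw_atlas AM. \<forall>p\<in>fst c \<inter> \<psi> -` fst d.
             pfw_metric H gM d (snd d (\<psi> p))
               (mean_curvature_vector g (pfw_metric H gM) \<psi> c d p) partial_v \<ge> 0) \<longrightarrow>
          (\<forall>p. fst (\<psi> p) \<ge> u\<^sub>0) \<longrightarrow>
          ((fst \<circ> \<psi>) \<longlongrightarrow> u\<^sub>0) (filtercomap (\<lambda>p. riemannian_dist A g p p\<^sub>0) at_top) \<longrightarrow>
          (\<forall>p. fst (\<psi> p) = u\<^sub>0)) \<and>
         ((\<forall>c\<in>A. \<forall>d\<in>pfw_atlas AM. \<forall>p\<in>fst c \<inter> \<psi> -` fst d.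
             pfw_metric H gM d (snd d (\<psi> p))
               (mean_curvature_vector g (pfw_metric H gM) \<psi> c d p) partial_v \<le> 0) \<longrightarrow>
          (\<forall>p. fst (\<psi> p) \<le> u\<^sub>0) \<longrightarrow>
          ((fst \<circ> \<psi>) \<longlongrightarrow> u\<^sub>0) (filtercomap (\<lambda>p. riemannian_dist A g p p\<^sub>0) at_top) \<longrightarrow>
          (\<forall>p. fst (\<psi> p) = u\<^sub>0))"
proof -
  have cont: "continuous_on UNIV (\<lambda>p. \<sigma> * fst (\<psi> p))" for \<sigma> :: real
    using assms(4) unfolding spacelike_submanifold_def immersion_def smooth_map_def
    by (intro continuous_intros) auto
  have main: "fst (\<psi> p) = u\<^sub>0"
    if \<sigma>: "\<sigma> = 1 \<or> \<sigma> = - 1"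
      and curv: "\<And>c d p. c \<in> A \<Longrightarrow> d \<in> pfw_atlas AM \<Longrightarrow> p \<in> fst c \<inter> \<psi> -` fst d \<Longrightarrow>
        0 \<le> \<sigma> * pfw_metric H gM d (snd d (\<psi> p))
               (mean_curvature_vector g (pfw_metric H gM) \<psi> c d p) partial_v"
      and ge: "\<And>p. \<sigma> * u\<^sub>0 \<le> \<sigma> * fst (\<psi> p)"
      and lim: "((fst \<circ> \<psi>) \<longlongrightarrow> u\<^sub>0) (filtercomap (\<lambda>p. riemannian_dist A g p p\<^sub>0) at_top)"
    for \<sigma> p
  proof -
    note sub = u_component_subharmonic[OF assms(1-4) curv]
    have "((\<lambda>p. \<sigma> * fst (\<psi> p)) \<longlongrightarrow> \<sigma> * u\<^sub>0) (filtercomap (\<lambda>p. riemannian_dist A g p p\<^sub>0) at_top)"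
      using tendsto_mult_left[OF lim, of \<sigma>] by (simp add: o_def)
    from connected_riemannian_manifold.subharmonic_vanishing_at_infinity
        [OF sub(1) assms(5,7) cont sub(2) ge this]
    show ?thesis using \<sigma> by auto
  qed
  show ?thesis
    using main[of 1] main[of "- 1"] by auto
qed

end
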